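(* Let $\mathbb F$ be a field, let $0\neq q\in\mathbb F$ be not a root of unity, and let $\mathcal U^+_q$ be the alternating central extension of $U^+_q$. A PBW basis for $\mathcal U^+_q$ is obtained by its alternating generators in any linear order $<$ such that $$\mathcal G_{i+1} < \mathcal W_{-j} < \mathcal W_{k+1} < \mathcal {\tilde G}_{\ell+1}\qquad\text{for all } i,j,k,\ell\in\mathbb N.$$
   Context: Algebras are associative, unital, over $\mathbb F$. For elements $X,Y$ of an algebra: $[X,Y]=XY-YX$, $[X,Y]_q=qXY-q^{-1}YX$. $\mathbb N=\{0,1,2,\ldots\}$. A PBW basis for an algebra $\mathcal A$ consists of a subset $\Omega\subseteq\mathcal A$ and a linear order $<$ on $\Omega$ such that the products $a_1a_2\cdots a_n$ with $n\in\mathbb N$, $a_1,\ldots,a_n\in\Omega$, $a_1\le a_2\le\cdots\le a_n$ form a basis of the vector space $\mathcal A$ (the empty product being $1$). The algebra $\mathcal U^+_q$ is defined by generators $\{\mathcal W_{-k}\}_{k\in\mathbb N}$, $\{\mathcal W_{k+1}\}_{k\in\mathbb N}$, $\{\mathcal G_{k+1}\}_{k\in\mathbb N}$, $\{\mathcal{\tilde G}_{k+1}\}_{k\in\mathbb N}$ (called the alternating generators) and the relations, for all $k,\ell\in\mathbb N$: $[\mathcal W_0,\mathcal W_{k+1}]=[\mathcal W_{-k},\mathcal W_1]=(1-q^{-2})(\mathcal{\tilde G}_{k+1}-\mathcal G_{k+1})$; $[\mathcal W_0,\mathcal G_{k+1}]_q=[\mathcal{\tilde G}_{k+1},\mathcal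 W_0]_q=(q-q^{-1})\mathcal W_{-k-1}$; $[\mathcal G_{k+1},\mathcal W_1]_q=[\mathcal W_1,\mathcal{\tilde G}_{k+1}]_q=(q-q^{-1})\mathcal W_{k+2}$; $[\mathcal W_{-k},\mathcal W_{-\ell}]=0$, $[\mathcal W_{k+1},\mathcal W_{\ell+1}]=0$; $[\mathcal W_{-k},\mathcal W_{\ell+1}]+[\mathcal W_{k+1},\mathcal W_{-\ell}]=0$; $[\mathcal W_{-k},\mathcal G_{\ell+1}]+[\mathcal G_{k+1},\mathcal W_{-\ell}]=0$; $[\mathcal W_{-k},\mathcal{\tilde G}_{\ell+1}]+[\mathcal{\tilde G}_{k+1},\mathcal W_{-\ell}]=0$; $[\mathcal W_{k+1},\mathcal G_{\ell+1}]+[\mathcal G_{k+1},\mathcal W_{\ell+1}]=0$; $[\mathcal W_{k+1},\mathcal{\tilde G}_{\ell+1}]+[\mathcal{\tilde G}_{k+1},\mathcal W_{\ell+1}]=0$; $[\mathcal G_{k+1},\mathcal G_{\ell+1}]=0$, $[\mathcal{\tilde G}_{k+1},\mathcal{\tilde G}_{\ell+1}]=0$; $[\mathcal{\tilde G}_{k+1},\mathcal G_{\ell+1}]+[\mathcal G_{k+1},\mathcal{\tilde G}_{\ell+1}]=0$. *)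

theory Defs
  imports "Jordan_Normal_Form.VS_Connect" "HOL-Algebra.QuotRing" "HOL-Library.Poly_Mapping"
begin

section \<open>Algebras and PBW bases\<close>

text \<open>The locale \<^locale>\<open>algebra\<close> of HOL-Algebra assumes commutativity, hence the following
  associative unital version over a field.\<close>

locale assoc_algebra = vectorspace K A + A: ring A
  for K :: "('a, 'b) ring_scheme" and A :: "('a, 'c, 'd) module_scheme" +
  assumes smult_mult_left:
      "\<lbrakk>c \<in> carrier K; x \<in> carrier A; y \<in> carrier A\<rbrakk> \<Longrightarrow>
        (c \<odot>\<^bsub>A\<^esub> x) \<otimes>\<^bsub>A\<^esub> y = c \<odot>\<^bsub>A\<^esub> (x \<otimes>\<^bsub>A\<^esub> y)"
    and smult_mult_right:
      "\<lbrakk>c \<in> carrier K; x \<in> carrier A; y \<in> carrier A\<rbrakk> \<Longrightarrow>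
        x \<otimes>\<^bsub>A\<^esub> (c \<odot>\<^bsub>A\<^esub> y) = c \<odot>\<^bsub>A\<^esub> (x \<otimes>\<^bsub>A\<^esub> y)"

definition list_prod :: "('a, 'b) monoid_scheme \<Rightarrow> 'a list \<Rightarrow> 'a"
  where "list_prod A xs = foldr (\<otimes>\<^bsub>A\<^esub>) xs \<one>\<^bsub>A\<^esub>"

text \<open>In a linear order \<open>r\<close>, the pair \<open>(x, y) \<in> r\<close> means \<open>x \<le> y\<close>.\<close>

definition nondecreasing_words :: "'a set \<Rightarrow> 'a rel \<Rightarrow> 'a list set"
  where "nondecreasing_words \<Omega> r = {xs. set xs \<subseteq> \<Omega> \<and> sorted_wrt (\<lambda>x y. (x, y) \<in> r) xs}"

text \<open>The products of nondecreasing words form a basis as a family indexed by the words.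
  The predicate \<^const>\<open>vectorspace.basis\<close> only speaks about the set of products, so injectivity is
  required separately.\<close>

definition (in assoc_algebra) PBW_basis :: "'c set \<Rightarrow> 'c rel \<Rightarrow> bool"
  where "PBW_basis \<Omega> r \<longleftrightarrow>
    \<Omega> \<subseteq> carrier A \<and> linear_order_on \<Omega> r \<and>
    inj_on (list_prod A) (nondecreasing_words \<Omega> r) \<and>
    basis (list_prod A ` nondecreasing_words \<Omega> r)"


section \<open>Algebras defined by generators and relations\<close>

datatype 'g free_monoid = Word "'g list"

instantiation free_monoid :: (type) monoid_add
begin

definition zero_free_monoid :: "'a free_monoid"
  where "0 = Word []"

fun plus_free_monoid :: "'a free_monoid \<Rightarrow> 'a free_monoid \<Rightarrow> 'a free_monoid"
  where "Word u + Word v = Word (u @ v)"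

instance
proof
  fix a b c :: "'a free_monoid"
  show "a + b + c = a + (b + c)"
    by (cases a; cases b; cases c) simp
  show "0 + a = a" "a + 0 = a"
    by (cases a; simp add: zero_free_monoid_def)+
qed

end

text \<open>The free associative algebra is the monoid algebra of the free monoid; its multiplication is
  the convolution product of \<^type>\<open>poly_mapping\<close>.\<close>

type_synonym ('g, 'k) free_algebra = "'g free_monoid \<Rightarrow>\<^sub>0 'k"

definition scalar :: "'k \<Rightarrow> ('g, 'k::field) free_algebra"
  where "scalar c = Poly_Mapping.single 0 c"

definition gen :: "'g \<Rightarrow> ('g, 'k::field) free_algebra"
  where "gen g = Poly_Mapping.single (Word [g]) 1"

text \<open>A relation \<open>x = y\<close> is given by the pair \<open>(x, y)\<close>; ideals of HOL-Algebra are two-sided.\<close>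

definition relation_ideal ::
    "(('g, 'k) free_algebra \<times> ('g, 'k) free_algebra) set \<Rightarrow> ('g, 'k::field) free_algebra set"
  where "relation_ideal E = Idl\<^bsub>class_ring\<^esub> ((\<lambda>(x, y). x - y) ` E)"

definition coset ::
    "(('g, 'k) free_algebra \<times> ('g, 'k) free_algebra) set \<Rightarrow>
      ('g, 'k) free_algebra \<Rightarrow> ('g, 'k::field) free_algebra set"
  where "coset E x = relation_ideal E +>\<^bsub>class_ring\<^esub> x"

definition presented_algebra ::
    "(('g, 'k) free_algebra \<times> ('g, 'k) free_algebra) set \<Rightarrow>
      ('k::field, ('g, 'k) free_algebra set) module"
  where "presented_algebra E =
    (let Q = class_ring Quot relation_ideal E in
      ring.extend Q (module.fields (\<lambda>c X. coset E (scalar c) \<otimes>\<^bsub>Q\<^esub> X)))"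

lemma ideal_relation_ideal: "ideal (relation_ideal E) class_ring"
  unfolding relation_ideal_def
  by (rule ring.genideal_ideal) (simp_all add: class_ring.ring_axioms)

lemma presented_algebra_simps:
  "carrier (presented_algebra E) = range (coset E)"
  "coset E x \<oplus>\<^bsub>presented_algebra E\<^esub> coset E y = coset E (x + y)"
  "coset E x \<otimes>\<^bsub>presented_algebra E\<^esub> coset E y = coset E (x * y)"
  "c \<odot>\<^bsub>presented_algebra E\<^esub> coset E x = coset E (scalar c * x)"
  "\<zero>\<^bsub>presented_algebra E\<^esub> = coset E 0"
  "\<one>\<^bsub>presented_algebra E\<^esub> = coset E 1"
proof -
  interpret I: ideal "relation_ideal E" class_ring by (rule ideal_relation_ideal)
  have mult: "rcoset_mult class_ring (relation_ideal E) (coset E u) (coset E v) = coset E (u * v)"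
    for u v using I.rcoset_mult_add[of u v] by (simp add: coset_def)
  show "carrier (presented_algebra E) = range (coset E)"
    by (auto simp: presented_algebra_def Let_def FactRing_def ring.defs module.defs coset_def
        A_RCOSETS_def' image_def)
  show "coset E x \<oplus>\<^bsub>presented_algebra E\<^esub> coset E y = coset E (x + y)"
    using I.a_rcos_sum[of x y]
    by (simp add: presented_algebra_def Let_def FactRing_def ring.defs module.defs coset_def)
  show "coset E x \<otimes>\<^bsub>presented_algebra E\<^esub> coset E y = coset E (x * y)"
    by (simp add: presented_algebra_def Let_def FactRing_def ring.defs module.defs mult)
  show "c \<odot>\<^bsub>presented_algebra E\<^esub> coset E x = coset E (scalar c * x)"
    by (simp add: presented_algebra_def Let_def FactRing_def ring.defs module.defs mult)
  show "\<zero>\<^bsub>presented_algebra E\<^esub> = coset E 0"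
    by (simp add: presented_algebra_def Let_def FactRing_def ring.defs module.defs coset_def
        a_r_coset_def')
  show "\<one>\<^bsub>presented_algebra E\<^esub> = coset E 1"
    by (simp add: presented_algebra_def Let_def FactRing_def ring.defs module.defs coset_def)
qed

lemma scalar_simps:
  "scalar (a + b) = scalar a + scalar b"
  "scalar (a * b) = scalar a * scalar b"
  "scalar 1 = 1"
  by (simp_all add: scalar_def single_add mult_single)

lemma scalar_commute: "x * scalar c = scalar c * (x :: ('g, 'k::field) free_algebra)"
proof (induction x rule: Poly_Mapping.update_induct)
  case const
  show ?case by simp
next
  case (update f a b)
  have "Poly_Mapping.update a b f = Poly_Mapping.single a b + f"
    using update(1)
    by (intro poly_mapping_eqI)
      (auto simp: lookup_update lookup_add lookup_single when_def in_keys_iff)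
  moreover have "Poly_Mapping.single a b * scalar c = scalar c * Poly_Mapping.single a b"
    by (simp add: scalar_def mult_single mult.commute)
  ultimately show ?case
    using update(3) by (simp add: distrib_left distrib_right)
qed

lemma assoc_algebra_presented_algebra:
  "assoc_algebra class_ring (presented_algebra E)"
proof -
  let ?A = "presented_algebra E"
  have ring: "ring ?A"
  proof (rule ringI)
    show "abelian_group ?A"
    proof (rule abelian_groupI)
      fix x assume "x \<in> carrier ?A"
      then obtain u where "x = coset E u" by (auto simp: presented_algebra_simps)
      then show "\<exists>y\<in>carrier ?A. y \<oplus>\<^bsub>?A\<^esub> x = \<zero>\<^bsub>?A\<^esub>"
        by (intro bexI[of _ "coset E (- u)"]) (auto simp: presented_algebra_simps)
    qed (auto simp: presented_algebra_simps algebra_simps)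
    show "Group.monoid ?A"
      by unfold_locales (auto simp: presented_algebra_simps algebra_simps)
  qed (auto simp: presented_algebra_simps algebra_simps)
  then interpret ring ?A .
  have "module class_ring ?A"
    by (rule moduleI)
      (auto simp: presented_algebra_simps scalar_simps algebra_simps class_cring.is_cring
        is_abelian_group)
  then have vs: "vectorspace class_ring ?A"
    by (intro vectorspace.intro class_field)
  have *: "x * (scalar c * y) = scalar c * (x * y)" for c and x y :: "('b, 'a) free_algebra"
    by (metis mult.assoc scalar_commute)
  show ?thesis
    by (intro assoc_algebra.intro vs ring assoc_algebra_axioms.intro)
      (auto simp: presented_algebra_simps mult.assoc *)
qed


section \<open>The alternating central extension of the positive part\<close>

text \<open>The constructors applied to \<open>k\<close> stand for the generators \<open>W\<^bsub>-k\<^esub>\<close>, \<open>W\<^bsub>k+1\<^esub>\<close>, \<open>G\<^bsub>k+1\<^esub>\<close> and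
  \<open>G\<^bsub>k+1\<^esub>\<close> with a tilde, respectively.\<close>

datatype alt_gen = W_neg nat | W_pos nat | G_plain nat | G_tilde nat

abbreviation Wn :: "nat \<Rightarrow> (alt_gen, 'k::field) free_algebra"
  where "Wn k \<equiv> gen (W_neg k)"

abbreviation Wp :: "nat \<Rightarrow> (alt_gen, 'k::field) free_algebra"
  where "Wp k \<equiv> gen (W_pos k)"

abbreviation Gp :: "nat \<Rightarrow> (alt_gen, 'k::field) free_algebra"
  where "Gp k \<equiv> gen (G_plain k)"

abbreviation Gt :: "nat \<Rightarrow> (alt_gen, 'k::field) free_algebra"
  where "Gt k \<equiv> gen (G_tilde k)"

definition comm :: "('g, 'k) free_algebra \<Rightarrow> ('g, 'k) free_algebra \<Rightarrow> ('g, 'k::field) free_algebra"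
  where "comm x y = x * y - y * x"

definition qcomm ::
    "'k \<Rightarrow> ('g, 'k) free_algebra \<Rightarrow> ('g, 'k) free_algebra \<Rightarrow> ('g, 'k::field) free_algebra"
  where "qcomm q x y = scalar q * x * y - scalar (inverse q) * y * x"

text \<open>A chain of equations \<open>x = y = z\<close> contributes the pairs \<open>(x, z)\<close> and \<open>(y, z)\<close>.\<close>

inductive_set alt_relations ::
    "'k::field \<Rightarrow> ((alt_gen, 'k) free_algebra \<times> (alt_gen, 'k) free_algebra) set"
  for q :: "'k::field" where
  "(comm (Wn 0) (Wp k), scalar (1 - inverse q ^ 2) * (Gt k - Gp k)) \<in> alt_relations q"
| "(comm (Wn k) (Wp 0), scalar (1 - inverse q ^ 2) * (Gt k - Gp k)) \<in> alt_relations q"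
| "(qcomm q (Wn 0) (Gp k), scalar (q - inverse q) * Wn (Suc k)) \<in> alt_relations q"
| "(qcomm q (Gt k) (Wn 0), scalar (q - inverse q) * Wn (Suc k)) \<in> alt_relations q"
| "(qcomm q (Gp k) (Wp 0), scalar (q - inverse q) * Wp (Suc k)) \<in> alt_relations q"
| "(qcomm q (Wp 0) (Gt k), scalar (q - inverse q) * Wp (Suc k)) \<in> alt_relations q"
| "(comm (Wn k) (Wn l), 0) \<in> alt_relations q"
| "(comm (Wp k) (Wp l), 0) \<in> alt_relations q"
| "(comm (Wn k) (Wp l) + comm (Wp k) (Wn l), 0) \<in> alt_relations q"
| "(comm (Wn k) (Gp l) + comm (Gp k) (Wn l), 0) \<in> alt_relations q"
| "(comm (Wn k) (Gt l) + comm (Gt k) (Wn l), 0) \<in> alt_relations q"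
| "(comm (Wp k) (Gp l) + comm (Gp k) (Wp l), 0) \<in> alt_relations q"
| "(comm (Wp k) (Gt l) + comm (Gt k) (Wp l), 0) \<in> alt_relations q"
| "(comm (Gp k) (Gp l), 0) \<in> alt_relations q"
| "(comm (Gt k) (Gt l), 0) \<in> alt_relations q"
| "(comm (Gt k) (Gp l) + comm (Gp k) (Gt l), 0) \<in> alt_relations q"

definition alt_algebra :: "'k::field \<Rightarrow> ('k, (alt_gen, 'k) free_algebra set) module"
  where "alt_algebra q = presented_algebra (alt_relations q)"

definition alt_elem :: "'k::field \<Rightarrow> alt_gen \<Rightarrow> (alt_gen, 'k) free_algebra set"
  where "alt_elem q g = coset (alt_relations q) (gen g)"

lemma assoc_algebra_alt_algebra: "assoc_algebra class_ring (alt_algebra q)"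
  unfolding alt_algebra_def by (rule assoc_algebra_presented_algebra)

end

theory Submission
  imports Defs "HOL-Library.Multiset"
begin

text \<open>Put \<open>p = q\<^sup>-\<^sup>2\<close> and write \<open>W\<close>, \<open>V\<close>, \<open>G\<close>, \<open>H\<close> for the four sequences of generators, where \<open>G\<close>
  and \<open>H\<close> start with \<open>G\<^sub>0 = H\<^sub>0 = 1\<close>. The defining relations imply further quadratic relations, and
  these show that, modulo smaller monomials, each wrongly ordered product of two generators depends
  on the sum of the two indices only. As it is smaller for index zero, the nondecreasing words span.

  For linear independence we use that solutions of the relations can be multiplied, like the
  \<open>2 \<times> 2\<close> matrices \<open>(G(t), W(t); t V(t), H(t))\<close> of generating functions, provided that the entries
  of the factors commute up to suitable powers of \<open>q\<close>. A product of matrices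
  \<open>(1 + t s\<^sub>n b\<^sub>n, b\<^sub>n; t (c\<^sub>n + s\<^sub>n + s'\<^sub>n), 1 + t b\<^sub>n s'\<^sub>n)\<close> over a quantum torus is
  such a solution. For weights that decrease with \<open>n\<close>, the leading monomials of its coefficients
  have linearly independent exponents. Since leading monomials in a quantum torus are multiplicative up to
  nonzero scalars, distinct nondecreasing words have distinct leading monomials.\<close>

section \<open>Consequences of the defining relations\<close>

definition bracket :: "'a::ring \<Rightarrow> 'a \<Rightarrow> 'a"
  where "bracket x y = x * y - y * x"

text \<open>For \<open>p\<close> = q^-2 this is q^-1 times the q-commutator [x, y]_q. The parameter
  is a ring element, so that the same notion serves the free algebra and the operators.\<close>

definition qbracket :: "'a::ring \<Rightarrow> 'a \<Rightarrow> 'a \<Rightarrow> 'a"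
  where "qbracket p x y = x * y - p * (y * x)"

lemma bracket_trivial [simp]:
  "bracket x 1 = 0" "bracket 1 x = 0" "bracket x 0 = 0" "bracket 0 x = 0" for x :: "'a::ring_1"
  by (simp_all add: bracket_def)

lemma qbracket_zero [simp]: "qbracket r x 0 = 0" "qbracket r 0 x = 0"
  by (simp_all add: qbracket_def)

text \<open>On coefficient sequences, multiplication of the generating function by the variable.\<close>

definition shift :: "(nat \<Rightarrow> 'a::zero) \<Rightarrow> nat \<Rightarrow> 'a"
  where "shift f k = (case k of 0 \<Rightarrow> 0 | Suc j \<Rightarrow> f j)"

lemma shift_simps [simp]: "shift f 0 = 0" "shift f (Suc k) = f k"
  by (simp_all add: shift_def)

text \<open>Working modulo a two-sided ideal \<open>I\<close> lets one development cover both the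
  free algebra, with \<open>I = alt_ideal q\<close>, and the operator model, with
  \<open>I = {0}\<close>. \<open>V k\<close> is the generator W_{k+1}, whereas \<open>G\<close> and
  \<open>H\<close> keep their index; thus \<open>G 0 = H 0 = 1\<close> makes the relations with
  \<open>W 0\<close> and \<open>V 0\<close> uniform in \<open>k\<close>.\<close>

locale alternating =
  fixes I :: "'a::ring_1 set" and p p' u :: 'a and W V G H :: "nat \<Rightarrow> 'a"
  assumes I_zero: "0 \<in> I"
    and I_diff: "x \<in> I \<Longrightarrow> y \<in> I \<Longrightarrow> x - y \<in> I"
    and I_left: "x \<in> I \<Longrightarrow> y * x \<in> I"
    and I_right: "x \<in> I \<Longrightarrow> x * y \<in> I"
    and p_central: "x * p = p * x"
    and p'_central: "x * p' = p' * x"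
    and pp': "p * p' = 1"
    and u: "u * (1 - p) = 1"
    and G_0: "G 0 = 1" and H_0: "H 0 = 1"
    and WV_0: "bracket (W 0) (V k) - (1 - p) * (H (Suc k) - G (Suc k)) \<in> I"
    and VW_0: "bracket (V 0) (W k) - (1 - p) * (G (Suc k) - H (Suc k)) \<in> I"
    and WG_0: "qbracket p (W 0) (G k) - (1 - p) * W k \<in> I"
    and HW_0: "qbracket p (H k) (W 0) - (1 - p) * W k \<in> I"
    and VH_0: "qbracket p (V 0) (H k) - (1 - p) * V k \<in> I"
    and GV_0: "qbracket p (G k) (V 0) - (1 - p) * V k \<in> I"
    and WW: "bracket (W k) (W l) \<in> I" and VV: "bracket (V k) (V l) \<in> I"
    and GG: "bracket (G k) (G l) \<in> I" and HH: "bracket (H k) (H l) \<in> I"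
    and WV: "bracket (W k) (V l) - bracket (W l) (V k) \<in> I"
    and WG: "bracket (W k) (G (Suc l)) - bracket (W l) (G (Suc k)) \<in> I"
    and WH: "bracket (W k) (H (Suc l)) - bracket (W l) (H (Suc k)) \<in> I"
    and VH: "bracket (V k) (H (Suc l)) - bracket (V l) (H (Suc k)) \<in> I"
    and VG: "bracket (V k) (G (Suc l)) - bracket (V l) (G (Suc k)) \<in> I"
    and HG: "bracket (H k) (G l) - bracket (H l) (G k) \<in> I"
begin

lemma I_minus: "x \<in> I \<Longrightarrow> - x \<in> I"
  using I_diff[OF I_zero] by simp

lemma I_add: "x \<in> I \<Longrightarrow> y \<in> I \<Longrightarrow> x + y \<in> I"
  using I_diff[of x "- y"] I_minus by simp

lemmas I_closed = I_add I_diff I_minus I_left I_right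

lemma bracket_closed: "y \<in> I \<Longrightarrow> bracket x y \<in> I"
  by (simp add: bracket_def I_closed)

lemma qbracket_closed: "y \<in> I \<Longrightarrow> qbracket p x y \<in> I"
  by (simp add: qbracket_def I_closed)

text \<open>The exchange of \<open>W\<close> with \<open>V\<close> and of \<open>G\<close> with
  \<open>H\<close> permutes the axioms, so every consequence below also has a mirrored form.\<close>

lemma swap: "alternating I p p' u V W H G"
proof
  fix k l
  show "bracket (V k) (W l) - bracket (V l) (W k) \<in> I"
    using WV[of k l] by (simp add: bracket_def algebra_simps)
  show "bracket (G k) (H l) - bracket (G l) (H k) \<in> I"
    using HG[of k l] by (simp add: bracket_def algebra_simps)
qed (rule WV_0 VW_0 WG_0 HW_0 VH_0 GV_0 WW VV GG HH WG WH VG VH p_central p'_central pp' u G_0 H_0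
    I_zero | erule (1) I_diff | erule I_left I_right)+

lemma cancel_1p: "(1 - p) * x \<in> I \<Longrightarrow> x \<in> I"
  using I_left[of "(1 - p) * x" u] by (simp add: mult.assoc[symmetric] u)

lemma p_left_commute: "x * (p * y) = p * (x * y)"
  by (metis p_central mult.assoc)

lemma p'_left_commute: "x * (p' * y) = p' * (x * y)"
  by (metis p'_central mult.assoc)

lemma p'p: "p' * p = 1"
  using p_central[of p'] pp' by simp

lemma pp'_cancel: "p * (p' * x) = x" "p' * (p * x) = x"
  by (simp_all add: mult.assoc[symmetric] pp' p'p)

text \<open>Pushes the central elements to the front of each monomial.\<close>

lemmas push = p_central[of "W i" for i] p_central[of "V i" for i]
  p_central[of "G i" for i] p_central[of "H i" for i]
  p_left_commute[of "W i" for i] p_left_commute[of "V i" for i]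
  p_left_commute[of "G i" for i] p_left_commute[of "H i" for i]
  p'_central[of "W i" for i] p'_central[of "V i" for i]
  p'_central[of "G i" for i] p'_central[of "H i" for i]
  p'_left_commute[of "W i" for i] p'_left_commute[of "V i" for i]
  p'_left_commute[of "G i" for i] p'_left_commute[of "H i" for i] pp' p'p pp'_cancel

text \<open>After multiplication by \<open>1 - p\<close>, each \<open>W k\<close> is a q-commutator
  of \<open>W 0\<close> with \<open>G k\<close>; then only commutators of \<open>G k\<close> and
  \<open>G l\<close> are left.\<close>

lemma WG_q: "qbracket p (W k) (G l) - qbracket p (W l) (G k) \<in> I"
proof (rule cancel_1p)
  define e where "e k = qbracket p (W 0) (G k) - (1 - p) * W k" for k
  have e: "e k \<in> I" for k
    using WG_0 by (simp add: e_def)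
  have "(1 - p) * (qbracket p (W k) (G l) - qbracket p (W l) (G k)) =
      W 0 * bracket (G k) (G l) - p * (p * (bracket (G k) (G l) * W 0))
      - (e k * G l - p * (G l * e k)) + (e l * G k - p * (G k * e l))"
    by (simp add: e_def qbracket_def bracket_def algebra_simps push)
  also have "\<dots> \<in> I"
    by (intro I_add I_diff; blast intro: I_left I_right e GG)
  finally show "(1 - p) * (qbracket p (W k) (G l) - qbracket p (W l) (G k)) \<in> I" .
qed

lemma HW_q: "qbracket p (H l) (W k) - qbracket p (H k) (W l) \<in> I"
proof (rule cancel_1p)
  define e where "e k = qbracket p (H k) (W 0) - (1 - p) * W k" for k
  have e: "e k \<in> I" for k
    using HW_0 by (simp add: e_def)
  have "(1 - p) * (qbracket p (H l) (W k) - qbracket p (H k) (W l)) =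
      bracket (H l) (H k) * W 0 - p * (p * (W 0 * bracket (H l) (H k)))
      - (H l * e k - p * (e k * H l)) + (H k * e l - p * (e l * H k))"
    by (simp add: e_def qbracket_def bracket_def algebra_simps push)
  also have "\<dots> \<in> I"
    by (intro I_add I_diff; blast intro: I_left I_right e HH)
  finally show "(1 - p) * (qbracket p (H l) (W k) - qbracket p (H k) (W l)) \<in> I" .
qed

text \<open>This is the relation \<open>WG\<close>, q-commuted with \<open>V 0\<close>:
  \<open>GV_0\<close> produces the terms in \<open>V\<close>, and \<open>VW_0\<close> those in
  \<open>G\<close> and \<open>H\<close>.\<close>

lemma WV_Suc:
  "bracket (W k) (V (Suc l)) - bracket (W l) (V (Suc k))
    + qbracket p (G (Suc k)) (H (Suc l)) - qbracket p (G (Suc l)) (H (Suc k)) \<in> I"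
    (is "?x \<in> I")
proof (rule cancel_1p)
  define g where "g l = qbracket p (G l) (V 0) - (1 - p) * V l" for l
  define n where "n k = bracket (V 0) (W k) - (1 - p) * (G (Suc k) - H (Suc k))" for k
  define m where "m = bracket (W k) (G (Suc l)) - bracket (W l) (G (Suc k))"
  have g: "g k \<in> I" and n: "n k \<in> I" for k
    using GV_0 VW_0 by (simp_all add: g_def n_def)
  have m: "m \<in> I"
    using WG by (simp add: m_def)
  have "(1 - p) * ?x = m * V 0 - p * (V 0 * m) - (bracket (W k) (g (Suc l)) - bracket (W l) (g
      (Suc k)))
      - qbracket p (G (Suc l)) (n k) + qbracket p (G (Suc k)) (n l)
      + (1 - p) * ((1 + p) * bracket (G (Suc k)) (G (Suc l)))"
    by (simp add: g_def n_def m_def qbracket_def bracket_def algebra_simps push)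
  also have "\<dots> \<in> I"
    by (intro I_add I_diff; blast intro: I_left I_right bracket_closed qbracket_closed g n m GG)
  finally show "(1 - p) * ?x \<in> I" .
qed

text \<open>\<open>VW_0\<close> eliminates \<open>H\<close> in favour of commutators of
  \<open>V 0\<close> with \<open>W\<close>. Moving \<open>V 0\<close> past \<open>G\<close> by
  \<open>GV_0\<close> gives the terms in \<open>V\<close>, and the rest is accounted for by
  \<open>WG_q\<close>.\<close>

lemma GH_Suc:
  "bracket (G k) (H (Suc l)) - bracket (G l) (H (Suc k))
    + p' * (qbracket p (W k) (V l) - qbracket p (W l) (V k)) \<in> I"
    (is "?x \<in> I")
proof (rule cancel_1p)
  define g where "g l = qbracket p (G l) (V 0) - (1 - p) * V l" for l
  define n where "n k = bracket (V 0) (W k) - (1 - p) * (G (Suc k) - H (Suc k))" for k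
  define s where "s = qbracket p (W k) (G l) - qbracket p (W l) (G k)"
  have g: "g k \<in> I" and n: "n k \<in> I" for k
    using GV_0 VW_0 by (simp_all add: g_def n_def)
  have s: "s \<in> I"
    using WG_q by (simp add: s_def)
  have "(1 - p) * ?x = bracket (G k) (n l) - bracket (G l) (n k)
      + (1 - p) * (bracket (G k) (G (Suc l)) - bracket (G l) (G (Suc k)))
      + p' * (s * V 0) - V 0 * s - g k * W l + p' * (W l * g k) + g l * W k - p' * (W k * g l)"
    by (simp add: g_def n_def s_def qbracket_def bracket_def algebra_simps push)
  also have "\<dots> \<in> I"
    by (intro I_add I_diff; blast intro: I_left I_right bracket_closed qbracket_closed g n s GG
        I_diff[OF GG GG])
  finally show "(1 - p) * ?x \<in> I" .
qed

text \<open>Delaying \<open>W\<close> by one index extends \<open>WV_Suc\<close> to index zero. If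
  exactly one index is zero, the claim is \<open>VW_0\<close> up to sign.\<close>

lemma WV_shift:
  "bracket (shift W k) (V l) - bracket (shift W l) (V k) + qbracket p (G k) (H l) - qbracket p (G
      l) (H k) \<in> I"
proof (cases k; cases l)
  fix l' assume "k = 0" "l = Suc l'"
  then show ?thesis
    using VW_0[of l'] by (simp add: bracket_def qbracket_def G_0 H_0 algebra_simps)
next
  fix k' assume "k = Suc k'" "l = 0"
  then show ?thesis
    using I_minus[OF VW_0[of k']] by (simp add: bracket_def qbracket_def G_0 H_0 algebra_simps)
next
  fix k' l' assume "k = Suc k'" "l = Suc l'"
  then show ?thesis
    using WV_Suc[of k' l'] by simp
qed (simp add: I_zero)

end

section \<open>Straightening products of two generators\<close>

text \<open>Modulo \<open>N\<close>, the first two conditions give a k (l+1) = a l (k+1) = a (k+1)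
  l. So \<open>a k l\<close> depends on k + l only and agrees with
  \<open>a (k + l) 0\<close>.\<close>

lemma symmetric_shift_vanish:
  fixes a :: "nat \<Rightarrow> nat \<Rightarrow> 'a::ab_group_add"
  assumes diff: "\<And>x y. x \<in> N \<Longrightarrow> y \<in> N \<Longrightarrow> x - y \<in> N"
    and sym: "\<And>k l. a k l - a l k \<in> N"
    and shift: "\<And>k l. a k (Suc l) - a l (Suc k) \<in> N"
    and zero: "\<And>k. a k 0 \<in> N"
  shows "a k l \<in> N"
proof (induction l arbitrary: k)
  case (Suc l)
  have "0 \<in> N"
    using diff zero by (metis diff_self)
  then have minus: "- x \<in> N" if "x \<in> N" for x
    using diff that by (metis diff_0)
  have "a k (Suc l) = a (Suc k) l - (- (a k (Suc l) - a l (Suc k))) - (- (a l (Suc k) - a (Suc k)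
      l))"
    by simp
  also have "\<dots> \<in> N"
    by (intro diff minus sym shift Suc)
  finally show ?case .
qed (rule zero)

text \<open>\<open>N\<close> stands for the span of the smaller monomials. It is closed only under
  differences and the central factors, because in the application it consists of the elements that
  land in a given subspace after multiplication by fixed words on both sides.\<close>

locale alternating_filter = alternating +
  fixes N :: "'a::ring_1 set"
  assumes N_diff: "x \<in> N \<Longrightarrow> y \<in> N \<Longrightarrow> x - y \<in> N"
    and N_p: "x \<in> N \<Longrightarrow> p * x \<in> N"
    and N_p': "x \<in> N \<Longrightarrow> p' * x \<in> N"
    and I_N: "x \<in> I \<Longrightarrow> x \<in> N"
begin

lemma swap_filter: "alternating_filter I p p' u V W H G N"
  using alternating_filter_axioms swap unfolding alternating_filter_def by blast

lemma N_add: "x \<in> N \<Longrightarrow> y \<in> N \<Longrightarrow> x + y \<in> N"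
  by (metis N_diff diff_self diff_0 diff_minus_eq_add)

text \<open>Modulo ordered products, \<open>WG_q\<close> gives symmetry in the two indices and
  \<open>WG\<close> the index shift. For \<open>l = 0\<close> the factor \<open>G 0 = 1\<close>
  leaves a single generator. The next three lemmas follow the same scheme.\<close>

lemma straighten_WG:
  assumes "\<And>k. W k \<in> N" "\<And>k l. G k * W l \<in> N"
  shows "W k * G l \<in> N"
proof (rule symmetric_shift_vanish[where N = N])
  fix k l
  have "W k * G l - W l * G k = (qbracket p (W k) (G l) - qbracket p (W l) (G k))
      + (p * (G l * W k) - p * (G k * W l))"
    by (simp add: qbracket_def)
  also have "\<dots> \<in> N"
    by (intro N_add N_diff N_p I_N[OF WG_q] assms)
  finally show "W k * G l - W l * G k \<in> N" .
  have "W k * G (Suc l) - W l * G (Suc k) = (bracket (W k) (G (Suc l)) - bracket (W l) (G (Suc k)))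
      + (G (Suc l) * W k - G (Suc k) * W l)"
    by (simp add: bracket_def)
  also have "\<dots> \<in> N"
    by (intro N_add N_diff I_N[OF WG] assms)
  finally show "W k * G (Suc l) - W l * G (Suc k) \<in> N" .
qed (simp_all add: G_0 assms N_diff)

lemma straighten_HW:
  assumes "\<And>k. W k \<in> N" "\<And>k l. W l * H k \<in> N"
  shows "H l * W k \<in> N"
proof (rule symmetric_shift_vanish[where N = N and a = "\<lambda>k l. H l * W k"])
  fix k l
  have "H l * W k - H k * W l = (qbracket p (H l) (W k) - qbracket p (H k) (W l))
      + (p * (W k * H l) - p * (W l * H k))"
    by (simp add: qbracket_def)
  also have "\<dots> \<in> N"
    by (intro N_add N_diff N_p I_N[OF HW_q] assms)
  finally show "H l * W k - H k * W l \<in> N" .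
  have "H (Suc l) * W k - H (Suc k) * W l = (W k * H (Suc l) - W l * H (Suc k))
      - (bracket (W k) (H (Suc l)) - bracket (W l) (H (Suc k)))"
    by (simp add: bracket_def)
  also have "\<dots> \<in> N"
    by (intro N_diff I_N[OF WH] assms)
  finally show "H (Suc l) * W k - H (Suc k) * W l \<in> N" .
qed (simp_all add: H_0 assms N_diff)

text \<open>The opposite direction of \<open>straighten_WG\<close>: now the unwanted products carry
  the factor \<open>p\<close>, which \<open>p'\<close> removes.\<close>

lemma straighten_GW:
  assumes "\<And>k. W k \<in> N" "\<And>k l. W k * G l \<in> N"
  shows "G l * W k \<in> N"
proof (rule symmetric_shift_vanish[where N = N and a = "\<lambda>k l. G l * W k"])
  fix k l
  have "G l * W k - G k * W l = p' * ((W k * G l - W l * G k)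
      - (qbracket p (W k) (G l) - qbracket p (W l) (G k)))"
    by (simp add: qbracket_def right_diff_distrib pp'_cancel)
  also have "\<dots> \<in> N"
    by (intro N_diff N_p' I_N[OF WG_q] assms)
  finally show "G l * W k - G k * W l \<in> N" .
  have "G (Suc l) * W k - G (Suc k) * W l = (W k * G (Suc l) - W l * G (Suc k))
      - (bracket (W k) (G (Suc l)) - bracket (W l) (G (Suc k)))"
    by (simp add: bracket_def)
  also have "\<dots> \<in> N"
    by (intro N_diff I_N[OF WG] assms)
  finally show "G (Suc l) * W k - G (Suc k) * W l \<in> N" .
qed (simp_all add: G_0 assms N_diff)

lemma straighten_WH:
  assumes "\<And>k. W k \<in> N" "\<And>k l. H l * W k \<in> N"
  shows "W k * H l \<in> N"
proof (rule symmetric_shift_vanish[where N = N])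
  fix k l
  have "W k * H l - W l * H k = p' * ((H l * W k - H k * W l)
      - (qbracket p (H l) (W k) - qbracket p (H k) (W l)))"
    by (simp add: qbracket_def right_diff_distrib pp'_cancel)
  also have "\<dots> \<in> N"
    by (intro N_diff N_p' I_N[OF HW_q] assms)
  finally show "W k * H l - W l * H k \<in> N" .
  have "W k * H (Suc l) - W l * H (Suc k) = (bracket (W k) (H (Suc l)) - bracket (W l) (H (Suc k)))
      + (H (Suc l) * W k - H (Suc k) * W l)"
    by (simp add: bracket_def)
  also have "\<dots> \<in> N"
    by (intro N_add N_diff I_N[OF WH] assms)
  finally show "W k * H (Suc l) - W l * H (Suc k) \<in> N" .
qed (simp_all add: H_0 assms N_diff)

context
  assumes single: "\<And>k. G k \<in> N" "\<And>k. H k \<in> N"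
    and pair: "\<And>k l. W k * V l \<in> N" "\<And>k l. G k * H l \<in> N"
begin

lemma straighten_VW: "V l * W k \<in> N"
proof (rule symmetric_shift_vanish[where N = N and a = "\<lambda>k l. V l * W k"])
  fix k l
  have "V l * W k - V k * W l = (W k * V l - W l * V k) - (bracket (W k) (V l) - bracket (W l) (V
      k))"
    by (simp add: bracket_def)
  also have "\<dots> \<in> N"
    by (intro N_diff I_N[OF WV] pair)
  finally show "V l * W k - V k * W l \<in> N" .
  \<comment> \<open>The q-brackets in \<open>WV_Suc\<close> contain products \<open>H * G\<close> in
    the wrong order, but only through a difference that \<open>HG\<close> turns into one of ordered
    products.\<close>
  have "V (Suc l) * W k - V (Suc k) * W l = (W k * V (Suc l) - W l * V (Suc k))
      + (G (Suc k) * H (Suc l) - G (Suc l) * H (Suc k))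
      + p * ((bracket (H (Suc k)) (G (Suc l)) - bracket (H (Suc l)) (G (Suc k)))
        + (G (Suc l) * H (Suc k) - G (Suc k) * H (Suc l)))
      - (bracket (W k) (V (Suc l)) - bracket (W l) (V (Suc k))
        + qbracket p (G (Suc k)) (H (Suc l)) - qbracket p (G (Suc l)) (H (Suc k)))"
    by (simp add: bracket_def qbracket_def algebra_simps)
  also have "\<dots> \<in> N"
    by (rule N_diff[OF _ I_N[OF WV_Suc]], rule N_add[OF _ N_p[OF N_add[OF I_N[OF HG]]]])
      (intro N_add N_diff pair)+
  finally show "V (Suc l) * W k - V (Suc k) * W l \<in> N" .
next
  fix k
  have "V 0 * W k = bracket (V 0) (W k) - (1 - p) * (G (Suc k) - H (Suc k)) + W k * V 0
      + ((G (Suc k) - H (Suc k)) - p * (G (Suc k) - H (Suc k)))"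
    by (simp add: bracket_def algebra_simps)
  also have "\<dots> \<in> N"
    by (rule N_add[OF N_add[OF I_N[OF VW_0]]]) (intro N_diff N_p pair single)+
  finally show "V 0 * W k \<in> N" .
qed (rule N_diff)

text \<open>The index shift comes from the mirrored \<open>GH_Suc\<close>. That relation involves
  products \<open>V * W\<close>, which is why \<open>straighten_VW\<close> comes first.\<close>

lemma straighten_HG: "H k * G l \<in> N"
proof (rule symmetric_shift_vanish[where N = N])
  fix k l
  have "H k * G l - H l * G k = (bracket (H k) (G l) - bracket (H l) (G k)) + (G l * H k - G k * H
      l)"
    by (simp add: bracket_def)
  also have "\<dots> \<in> N"
    by (rule N_add[OF I_N[OF HG]]) (intro N_diff pair)
  finally show "H k * G l - H l * G k \<in> N" .
  have "H k * G (Suc l) - H l * G (Suc k) = (bracket (H k) (G (Suc l)) - bracket (H l) (G (Suc k))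
        + p' * (qbracket p (V k) (W l) - qbracket p (V l) (W k)))
      + (G (Suc l) * H k - G (Suc k) * H l) + (W l * V k - W k * V l)
      - p' * (V k * W l - V l * W k)"
    by (simp add: bracket_def qbracket_def algebra_simps pp'_cancel)
  also have "\<dots> \<in> N"
    by (rule N_diff, rule N_add, rule N_add[OF I_N[OF alternating.GH_Suc[OF swap]]])
      (intro N_diff N_p' pair straighten_VW)+
  finally show "H k * G (Suc l) - H l * G (Suc k) \<in> N" .
qed (simp_all add: G_0 single N_diff)

end

end

section \<open>Multiplying a solution by an elementary one\<close>

text \<open>The four elements \<open>a, b, c, d\<close> are the entries of an elementary solution
  \<open>(1 + t a, b; t c, 1 + t d)\<close>, with which a given solution is multiplied.\<close>

locale alternating_step = alternating "{0}" p p' u W V G H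
  for p p' u :: "'a::ring_1" and W V G H +
  fixes a b c d :: 'a
  assumes site: "b * a = p * (a * b)" "d * b = p * (b * d)" "a * c = p * (c * a)"
      "c * d = p * (d * c)" "d * a = a * d" "b * c - c * b = (1 - p) * (d - a)"
    and W_a: "W k * a = a * W k" and W_b: "W k * b = p' * (b * W k)"
    and W_c: "W k * c = p * (c * W k)" and W_d: "W k * d = d * W k"
    and V_a: "V k * a = a * V k" and V_b: "V k * b = p * (b * V k)"
    and V_c: "V k * c = p' * (c * V k)" and V_d: "V k * d = d * V k"
    and G_a: "G k * a = a * G k" and G_b: "G k * b = b * G k"
    and G_c: "G k * c = c * G k" and G_d: "G k * d = d * G k"
    and H_a: "H k * a = a * H k" and H_b: "H k * b = b * H k"
    and H_c: "H k * c = c * H k" and H_d: "H k * d = d * H k"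
begin

text \<open>These four sequences are the entries of (G, W; t V, H) times (1 + t a, b; t c, 1 + t d),
  where in each product of entries the new factor is written on the left.\<close>

definition W' where "W' k = W k + b * G k + d * shift W k"
definition V' where "V' k = V k + c * H k + a * shift V k"
definition G' where "G' k = G k + a * shift G k + c * shift W k"
definition H' where "H' k = H k + d * shift H k + b * shift V k"

lemma shift_commute:
  "shift W k * a = a * shift W k" "shift W k * b = p' * (b * shift W k)"
  "shift W k * c = p * (c * shift W k)" "shift W k * d = d * shift W k"
  "shift V k * a = a * shift V k" "shift V k * b = p * (b * shift V k)"
  "shift V k * c = p' * (c * shift V k)" "shift V k * d = d * shift V k"
  "shift G k * a = a * shift G k" "shift G k * b = b * shift G k"
  "shift G k * c = c * shift G k" "shift G k * d = d * shift G k"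
  "shift H k * a = a * shift H k" "shift H k * b = b * shift H k"
  "shift H k * c = c * shift H k" "shift H k * d = d * shift H k"
  by (cases k; simp add: W_a W_b W_c W_d V_a V_b V_c V_d G_a G_b G_c G_d H_a H_b H_c H_d)+

lemma commute_left:
  fixes x y z :: 'a
  assumes "x * y = y * x" shows "x * (y * z) = y * (x * z)"
  by (simp add: mult.assoc[symmetric] assms)

lemma qcommute_left:
  fixes x y z r :: 'a
  assumes "x * y = r * (y * x)" shows "x * (y * z) = r * (y * (x * z))"
  by (simp add: mult.assoc[symmetric] assms)

text \<open>Among the site elements, \<open>b\<close> and \<open>c\<close> are the only pair whose
  exchange costs more than a power of \<open>p\<close>.\<close>

lemma bc: "b * c = c * b + (d - a) - p * (d - a)"
proof -
  have "b * c = (b * c - c * b) + c * b"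
    by simp
  also have "\<dots> = c * b + (d - a) - p * (d - a)"
    unfolding site(6) by (simp add: left_diff_distrib)
  finally show ?thesis .
qed

lemma bc_left: "b * (c * z) = c * (b * z) + (d * z - a * z) - p * (d * z - a * z)"
  by (simp add: mult.assoc[symmetric] bc) (simp add: left_diff_distrib distrib_right mult.assoc)

lemma dc: "d * c = p' * (c * d)"
  by (simp add: site(4) pp'_cancel)

lemmas old_site_commute = shift_commute W_a W_b W_c W_d V_a V_b V_c V_d G_a G_b G_c G_d H_a H_b
    H_c H_d

lemmas site_commute = site(1,2,3) dc site(5)

lemmas push_site =
  p_central[of a] p_central[of b] p_central[of c] p_central[of d]
  p_left_commute[of a] p_left_commute[of b] p_left_commute[of c] p_left_commute[of d]
  p'_central[of a] p'_central[of b] p'_central[of c] p'_central[of d]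
  p'_left_commute[of a] p'_left_commute[of b] p'_left_commute[of c] p'_left_commute[of d]
  p_central[of "shift W i" for i] p_central[of "shift V i" for i]
  p_central[of "shift G i" for i] p_central[of "shift H i" for i]
  p_left_commute[of "shift W i" for i] p_left_commute[of "shift V i" for i]
  p_left_commute[of "shift G i" for i] p_left_commute[of "shift H i" for i]
  p'_central[of "shift W i" for i] p'_central[of "shift V i" for i]
  p'_central[of "shift G i" for i] p'_central[of "shift H i" for i]
  p'_left_commute[of "shift W i" for i] p'_left_commute[of "shift V i" for i]
  p'_left_commute[of "shift G i" for i] p'_left_commute[of "shift H i" for i]

lemmas old_site_left =
  W_a[THEN commute_left] W_d[THEN commute_left] V_a[THEN commute_left] V_d[THEN commute_left]
  G_a[THEN commute_left] G_b[THEN commute_left] G_c[THEN commute_left] G_d[THEN commute_left]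
  H_a[THEN commute_left] H_b[THEN commute_left] H_c[THEN commute_left] H_d[THEN commute_left]
  shift_commute(1,4,5,8-16)[THEN commute_left]
  W_b[THEN qcommute_left] W_c[THEN qcommute_left] V_b[THEN qcommute_left] V_c[THEN qcommute_left]
  shift_commute(2,3,6,7)[THEN qcommute_left]
  site(1-3)[THEN qcommute_left] dc[THEN qcommute_left] site(5)[THEN commute_left]

text \<open>Normal forms: central elements first, then \<open>c, a, b, d\<close> in this order, then the old
  solution.\<close>

lemmas normalize = W'_def V'_def G'_def H'_def bracket_def qbracket_def algebra_simps push push_site
  old_site_commute old_site_left site_commute bc bc_left

lemma zero [simp]: "G 0 = 1" "H 0 = 1"
  by (rule G_0 H_0)+

lemmas relations = WW[simplified] VV[simplified] GG[simplified] HH[simplified] WV[simplified]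
  WG[simplified] WH[simplified] VG[simplified] VH[simplified] HG[simplified]
  WG_q[simplified] HW_q[simplified]
  alternating.WG_q[OF swap, simplified] alternating.HW_q[OF swap, simplified]

lemma GH_sym: "bracket (G k) (H l) = bracket (G l) (H k)"
  and VW_sym: "bracket (V k) (W l) = bracket (V l) (W k)"
  using HG[of k l] WV[of k l] by (simp_all add: bracket_def algebra_simps)

section \<open>The relations of the old solution in shifted form\<close>

lemma shift_same:
  "bracket (shift W k) (W l) = 0" "bracket (W k) (shift W l) = 0" "bracket (shift W k) (shift W l)
      = 0"
  "bracket (shift G k) (G l) = 0" "bracket (G k) (shift G l) = 0" "bracket (shift G k) (shift G l)
      = 0"
  by (cases k; cases l; simp add: relations)+

lemma shift_sym:
  "bracket (shift W k) (G l) = bracket (shift W l) (G k)"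
  "bracket (shift W k) (H l) = bracket (shift W l) (H k)"
  "bracket (shift V k) (G l) = bracket (shift V l) (G k)"
  "bracket (shift V k) (H l) = bracket (shift V l) (H k)"
  by (cases k; cases l; simp add: relations)+

lemma shift_sym':
  "bracket (H k) (shift W l) = bracket (H l) (shift W k)"
  "bracket (G k) (shift V l) = bracket (G l) (shift V k)"
  using shift_sym(2)[of k l] shift_sym(3)[of k l] by (simp_all add: bracket_def algebra_simps)

lemma shift_Suc:
  "bracket (shift W k) (G (Suc l)) = bracket (W l) (G k)"
  "bracket (shift W k) (H (Suc l)) = bracket (W l) (H k)"
  using shift_sym(1,2)[of k "Suc l"] by simp_all

lemma shift_shift_sym:
  "bracket (shift W k) (shift V l) = bracket (shift W l) (shift V k)"
  "bracket (shift V k) (shift W l) = bracket (shift V l) (shift W k)"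
  "bracket (shift H k) (shift G l) = bracket (shift H l) (shift G k)"
  "qbracket p (shift W k) (shift G l) = qbracket p (shift W l) (shift G k)"
  "qbracket p (shift H k) (shift W l) = qbracket p (shift H l) (shift W k)"
  "qbracket p (shift G k) (shift V l) = qbracket p (shift G l) (shift V k)"
  by (cases k; cases l; simp add: relations VW_sym)+

lemma shift_zero:
  "bracket (W 0) (shift V k) = (1 - p) * (H k - G k)"
  "qbracket p (W 0) (shift G k) = (1 - p) * shift W k"
  "qbracket p (shift H k) (W 0) = (1 - p) * shift W k"
  using WV_0 WG_0 HW_0 by (cases k; simp)+

lemma W_shift_V: "bracket (W k) (shift V l) = bracket (shift W l) (V k)"
proof (cases l)
  case 0
  then show ?thesis by simp
next
  case (Suc l')
  then show ?thesis
    using WV[of k l'] by simp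
qed

lemma shift_GH:
  "bracket (shift G k) (H l) - bracket (shift G l) (H k)
    + p' * (qbracket p (shift W k) (shift V l) - qbracket p (shift W l) (shift V k)) = 0"
proof (cases k; cases l)
  fix k' l' assume "k = Suc k'" "l = Suc l'"
  then show ?thesis
    using GH_Suc[of k' l'] by simp
qed simp_all

text \<open>The mirror symmetry extends to the new factor by exchanging \<open>a\<close> with
  \<open>d\<close> and \<open>b\<close> with \<open>c\<close>. It yields the second half of the
  relations of the product from the first half.\<close>

lemma swap_step: "alternating_step p p' u V W H G d c b a"
proof (intro alternating_step.intro swap alternating_step_axioms.intro)
  show "c * b - b * c = (1 - p) * (a - d)"
    unfolding bc by (simp add: algebra_simps)
qed (rule site site(5)[symmetric] old_site_commute)+

text \<open>The pattern for all relations of the product: in normal form, the coefficient of each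
  monomial in \<open>a\<close>, \<open>b\<close>, \<open>c\<close>, \<open>d\<close> is a
  combination of relations of the old solution.\<close>

lemma WW': "bracket (W' k) (W' l) = 0"
proof -
  have "bracket (W' k) (W' l) = bracket (W k) (W l)
      + p' * (b * (qbracket p (W k) (G l) - qbracket p (W l) (G k)))
      + d * (bracket (W k) (shift W l) + bracket (shift W k) (W l))
      + b * (b * bracket (G k) (G l))
      + b * (d * (bracket (shift W k) (G l) - bracket (shift W l) (G k)))
      + d * (d * bracket (shift W k) (shift W l))"
    by (simp add: normalize)
  then show ?thesis
    by (simp add: relations shift_same shift_sym)
qed

lemma GG': "bracket (G' k) (G' l) = 0"
proof -
  have "bracket (G' k) (G' l) = bracket (G k) (G l)
      + a * (bracket (shift G k) (G l) + bracket (G k) (shift G l))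
      + a * (a * bracket (shift G k) (shift G l))
      + c * (bracket (shift W k) (G l) - bracket (shift W l) (G k))
      + c * (a * (qbracket p (shift W k) (shift G l) - qbracket p (shift W l) (shift G k)))
      + p * (c * (c * bracket (shift W k) (shift W l)))"
    by (simp add: normalize)
  then show ?thesis
    by (simp add: relations shift_same shift_sym shift_shift_sym)
qed

lemma WG': "bracket (W' k) (G' (Suc l)) = bracket (W' l) (G' (Suc k))"
proof -
  define r where "r k l = bracket (shift W k) (G (Suc l)) - bracket (W l) (G k)" for k l
  define s where "s = qbracket p (W k) (G l) - qbracket p (W l) (G k)"
  have "bracket (W' k) (G' (Suc l)) - bracket (W' l) (G' (Suc k)) =
      bracket (W k) (G (Suc l)) - bracket (W l) (G (Suc k)) + a * s
      + c * ((1 + p) * bracket (W k) (W l)) + (1 + p) * (a * (b * bracket (G k) (G l)))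
      + p' * (c * (b * s)) + d * (r k l - r l k - s)
      + a * (d * (bracket (shift W k) (G l) - bracket (shift W l) (G k)))
      + c * (d * (bracket (shift W k) (W l) - bracket (shift W l) (W k)))
      + b * (bracket (G k) (G (Suc l)) - bracket (G l) (G (Suc k)))"
    unfolding r_def s_def by (simp add: normalize)
  moreover have "r k l = 0" "r l k = 0" "s = 0"
    by (simp_all add: r_def s_def relations shift_Suc)
  ultimately show ?thesis
    by (simp add: relations shift_same shift_sym)
qed

lemma WH': "bracket (W' k) (H' (Suc l)) = bracket (W' l) (H' (Suc k))"
proof -
  define r where "r k l = bracket (shift W k) (H (Suc l)) - bracket (W l) (H k)" for k l
  have "bracket (W' k) (H' (Suc l)) - bracket (W' l) (H' (Suc k)) =
      bracket (W k) (H (Suc l)) - bracket (W l) (H (Suc k))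
      + b * (bracket (G k) (H (Suc l)) - bracket (G l) (H (Suc k))
          + p' * (qbracket p (W k) (V l) - qbracket p (W l) (V k)))
      + d * (r k l - r l k)
      + b * (d * (bracket (shift W k) (V l) - bracket (shift W l) (V k)
          + qbracket p (G k) (H l) - qbracket p (G l) (H k)))
      + b * (b * (qbracket p (G k) (V l) - qbracket p (G l) (V k)))
      + d * (d * (bracket (shift W k) (H l) - bracket (shift W l) (H k)))"
    unfolding r_def by (simp add: normalize)
  moreover have "r k l = 0" "r l k = 0"
    by (simp_all add: r_def shift_Suc)
  ultimately show ?thesis
    using GH_Suc[of k l] WV_shift[of k l] by (simp add: relations shift_sym)
qed

lemma WV': "bracket (W' k) (V' l) = bracket (W' l) (V' k)"
proof -
  \<comment> \<open>Moving \<open>b\<close> past \<open>c\<close> contributes products of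
    \<open>G\<close> and \<open>H\<close> to the coefficients of \<open>a\<close> and
    \<open>d\<close>, so these combine several old relations. The names keep those relations
    together.\<close>
  define y where "y k l = bracket (W k) (shift V l) - bracket (shift W l) (V k)" for k l
  define t where "t = bracket (shift W k) (V l) - bracket (shift W l) (V k)
          + qbracket p (G k) (H l) - qbracket p (G l) (H k)"
  define g where "g = bracket (G k) (H l) - bracket (G l) (H k)"
  have "bracket (W' k) (V' l) - bracket (W' l) (V' k) = bracket (W k) (V l) - bracket (W l) (V k)
      - c * (qbracket p (H l) (W k) - qbracket p (H k) (W l))
      + b * (qbracket p (G k) (V l) - qbracket p (G l) (V k))
      + c * (b * g)
      + p * (a * (b * (bracket (G k) (shift V l) - bracket (G l) (shift V k))))
      + c * (d * (bracket (shift W k) (H l) - bracket (shift W l) (H k)))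
      + a * (d * (bracket (shift W k) (shift V l) - bracket (shift W l) (shift V k)))
      + a * (y k l - y l k - t + p * g) + d * (t - p * g)"
    unfolding y_def t_def g_def by (simp add: normalize)
  moreover have "y k l = 0" "y l k = 0" "t = 0" "g = 0"
    using WV_shift[of k l] by (simp_all add: y_def t_def g_def W_shift_V GH_sym)
  ultimately show ?thesis
    by (simp add: relations shift_sym shift_sym' shift_shift_sym)
qed

lemma HG': "bracket (H' k) (G' l) = bracket (H' l) (G' k)"
proof -
  define z where "z = bracket (shift G k) (H l) - bracket (shift G l) (H k)
          + p' * (qbracket p (shift W k) (shift V l) - qbracket p (shift W l) (shift V k))"
  define y where "y = bracket (shift H k) (G l) - bracket (shift H l) (G k)
          + p' * (qbracket p (shift V k) (shift W l) - qbracket p (shift V l) (shift W k))"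
  define w where "w = bracket (shift W k) (shift V l) - bracket (shift W l) (shift V k)"
  have "bracket (H' k) (G' l) - bracket (H' l) (G' k) = bracket (H k) (G l) - bracket (H l) (G k)
      + a * (z - p' * w) + d * (y - w)
      + c * (bracket (H k) (shift W l) - bracket (H l) (shift W k))
      + a * (d * (bracket (shift H k) (shift G l) - bracket (shift H l) (shift G k)))
      + p' * (c * (d * (qbracket p (shift H k) (shift W l) - qbracket p (shift H l) (shift W k))))
      + b * (bracket (shift V k) (G l) - bracket (shift V l) (G k))
      - a * (b * (qbracket p (shift G l) (shift V k) - qbracket p (shift G k) (shift V l)))
      + p' * (c * (b * (bracket (shift V k) (shift W l) - bracket (shift V l) (shift W k))))"
    unfolding z_def y_def w_def by (simp add: normalize)
  moreover have "z = 0" "y = 0" "w = 0"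
    \<comment> \<open>\<open>y\<close> is the left-hand side of \<open>shift_GH\<close> for the
      mirrored solution.\<close>
    using shift_GH[of k l] alternating_step.shift_GH[OF swap_step, of k l]
    by (simp_all add: z_def y_def w_def shift_shift_sym)
  ultimately show ?thesis
    by (simp add: relations shift_sym shift_sym' shift_shift_sym)
qed

lemma WV_0': "bracket (W' 0) (V' k) = (1 - p) * (H' (Suc k) - G' (Suc k))"
proof -
  have "bracket (W' 0) (V' k) - (1 - p) * (H' (Suc k) - G' (Suc k)) =
      bracket (W 0) (V k) - (1 - p) * (H (Suc k) - G (Suc k))
      + a * (bracket (W 0) (shift V k) - (1 - p) * (H k - G k))
      - c * (qbracket p (H k) (W 0) - (1 - p) * W k)"
    by (simp add: normalize)
  then show ?thesis
    using WV_0[of k] HW_0[of k] by (simp add: shift_zero)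
qed

lemma WG_0': "qbracket p (W' 0) (G' k) = (1 - p) * W' k"
proof -
  have "qbracket p (W' 0) (G' k) - (1 - p) * W' k =
      qbracket p (W 0) (G k) - (1 - p) * W k
      + a * (qbracket p (W 0) (shift G k) - (1 - p) * shift W k)
      + p * (c * bracket (W 0) (shift W k))"
    by (simp add: normalize)
  then show ?thesis
    using WG_0[of k] by (simp add: shift_zero shift_same)
qed

lemma HW_0': "qbracket p (H' k) (W' 0) = (1 - p) * W' k"
proof -
  have "qbracket p (H' k) (W' 0) - (1 - p) * W' k =
      qbracket p (H k) (W 0) - (1 - p) * W k
      + d * (qbracket p (shift H k) (W 0) - (1 - p) * shift W k)
      - b * (bracket (W 0) (shift V k) - (1 - p) * (H k - G k))"
    by (simp add: normalize)
  then show ?thesis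
    using HW_0[of k] by (simp add: shift_zero)
qed

theorem step: "alternating {0} p p' u W' V' G' H'"
proof -
  interpret sw: alternating_step p p' u V W H G d c b a
    by (rule swap_step)
  have sw: "sw.W' = V'" "sw.V' = W'" "sw.G' = H'" "sw.H' = G'"
    by (simp_all add: fun_eq_iff W'_def V'_def G'_def H'_def sw.W'_def sw.V'_def sw.G'_def
        sw.H'_def)
  show ?thesis
  proof
    show "G' 0 = 1" "H' 0 = 1"
      by (simp_all add: G'_def H'_def)
    show "x * p = p * x" "x * p' = p' * x" for x
      by (rule p_central p'_central)+
    show "bracket (W' 0) (V' k) - (1 - p) * (H' (Suc k) - G' (Suc k)) \<in> {0}" for k
      by (simp add: WV_0')
  qed (simp_all add: pp' u WV' WG' WH' HG' WW' GG' WG_0' HW_0'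
      sw.WW'[unfolded sw] sw.GG'[unfolded sw] sw.WG'[unfolded sw] sw.WH'[unfolded sw]
      sw.WV_0'[unfolded sw] sw.WG_0'[unfolded sw] sw.HW_0'[unfolded sw])
qed

end

section \<open>Operators of a quantum torus\<close>

text \<open>With operators in place of an abstract quantum torus, associativity is that of
  composition. They act on all functions, so finite support need not be tracked.\<close>

typedef (overloaded) ('i, 'k::field) lin_op =
  "{f :: ('i \<Rightarrow> 'k) \<Rightarrow> 'i \<Rightarrow> 'k.
    (\<forall>v w. f (\<lambda>i. v i + w i) = (\<lambda>i. f v i + f w i)) \<and> (\<forall>c v. f (\<lambda>i. c * v i) = (\<lambda>i. c * f v i))}"
  morphisms app Lin_op
  by (rule exI[of _ "\<lambda>v. v"]) simp

setup_lifting type_definition_lin_op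

lemma app_add: "app f (\<lambda>i. v i + w i) = (\<lambda>i. app f v i + app f w i)"
  and app_scale: "app f (\<lambda>i. c * v i) = (\<lambda>i. c * app f v i)"
  using app[of f] by auto

instantiation lin_op :: (type, field) ring_1
begin

lift_definition zero_lin_op :: "('a, 'b) lin_op" is "\<lambda>v i. 0"
  by simp

lift_definition one_lin_op :: "('a, 'b) lin_op" is "\<lambda>v. v"
  by simp

lift_definition plus_lin_op :: "('a, 'b) lin_op \<Rightarrow> ('a, 'b) lin_op \<Rightarrow> ('a, 'b) lin_op"
  is "\<lambda>f g v i. f v i + g v i"
  by (simp add: algebra_simps)

lift_definition uminus_lin_op :: "('a, 'b) lin_op \<Rightarrow> ('a, 'b) lin_op" is "\<lambda>f v i. - f v i"
  by simp

lift_definition minus_lin_op :: "('a, 'b) lin_op \<Rightarrow> ('a, 'b) lin_op \<Rightarrow> ('a, 'b) lin_op"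
  is "\<lambda>f g v i. f v i - g v i"
  by (simp add: algebra_simps)

lift_definition times_lin_op :: "('a, 'b) lin_op \<Rightarrow> ('a, 'b) lin_op \<Rightarrow> ('a, 'b) lin_op"
  is "\<lambda>f g v. f (g v)"
  by simp

instance
proof
  fix f g h :: "('a, 'b) lin_op"
  show "(0::('a, 'b) lin_op) \<noteq> 1"
    by transfer (metis zero_neq_one)
  show "f * (g + h) = f * g + f * h"
    by (simp add: app_inject[symmetric] fun_eq_iff times_lin_op.rep_eq plus_lin_op.rep_eq app_add)
qed (transfer; simp add: algebra_simps)+

end

lemmas app_simps = zero_lin_op.rep_eq one_lin_op.rep_eq plus_lin_op.rep_eq uminus_lin_op.rep_eq
  minus_lin_op.rep_eq times_lin_op.rep_eq

lemma lin_op_eqI: "(\<And>v i. app f v i = app g v i) \<Longrightarrow> f = g"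
  by (metis app_inject ext)

lift_definition scalar_op :: "'k::field \<Rightarrow> ('i, 'k) lin_op" is "\<lambda>c v i. c * v i"
  by (simp add: algebra_simps)

lemma scalar_op_simps:
  "scalar_op 0 = 0" "scalar_op 1 = 1" "scalar_op (x + y) = scalar_op x + scalar_op y" "scalar_op
      (x - y) = scalar_op x - scalar_op y" "scalar_op (x * y) = scalar_op x * scalar_op y"
  by (rule lin_op_eqI; simp add: app_simps scalar_op.rep_eq algebra_simps)+

lemma scalar_op_central: "f * scalar_op c = scalar_op c * f"
  by (rule lin_op_eqI) (simp add: app_simps scalar_op.rep_eq app_scale)

text \<open>The operators indexed by \<open>XB n\<close>, \<open>XC n\<close>, \<open>XS n\<close>, \<open>XT n\<close> are \<open>b\<^sub>n\<close>, \<open>c\<^sub>n\<close>, \<open>s\<^sub>n\<close>, \<open>s'\<^sub>n\<close>. They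
  act on functions of a multiset, which is the exponent of a monomial.\<close>

datatype coord = XB nat | XC nat | XS nat | XT nat

primrec site_of :: "coord \<Rightarrow> nat" where
  "site_of (XB n) = n" | "site_of (XC n) = n" | "site_of (XS n) = n" | "site_of (XT n) = n"

primrec charge :: "coord \<Rightarrow> int" where
  "charge (XB n) = 1" | "charge (XC n) = -1" | "charge (XS n) = -1" | "charge (XT n) = -1"

text \<open>Commutation depends only on \<open>local_twist i j - local_twist j i\<close>. The values
  are chosen to give the commutation rules assumed in \<open>site_relations\<close>.\<close>

fun local_twist :: "coord \<Rightarrow> coord \<Rightarrow> int" where
  "local_twist (XB _) (XS _) = -1"
| "local_twist (XB _) (XT _) = 1"
| "local_twist (XS _) (XT _) = -2"
| "local_twist (XS _) (XC _) = -1"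
| "local_twist (XC _) (XT _) = -1"
| "local_twist _ _ = 0"

text \<open>For different sites the exponent is the product of the charges. Hence a product of total
  charge m over earlier sites commutes with a later coordinate of charge e up to the factor
  \<open>r\<close> to the power m e, as \<open>alternating_step\<close> requires.\<close>

definition twist :: "coord \<Rightarrow> coord \<Rightarrow> int"
  where "twist i j = (if site_of i < site_of j then charge i * charge j
    else if site_of i = site_of j then local_twist i j else 0)"

text \<open>If a function of multisets is read as a formal combination of monomials, this is left
  multiplication by the coordinate \<open>i\<close>; the power of \<open>r\<close> is the cost of
  bringing it into its place.\<close>

lift_definition coord_op :: "'k::field \<Rightarrow> coord \<Rightarrow> (coord multiset, 'k) lin_op"
  is "\<lambda>r i v M. if i \<in># M then
    r powi (\<Sum>j\<in>#M - {#i#}. twist i j) * v (M - {#i#}) else 0"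
  by (simp add: algebra_simps if_distrib fun_eq_iff)

lemma coord_op_add: "app (coord_op r i) v (add_mset i M) = r powi (\<Sum>j\<in>#M. twist i j) * v M"
  by (simp add: coord_op.rep_eq)

lemma coord_op_notin: "i \<notin># M \<Longrightarrow> app (coord_op r i) v M = 0"
  by (simp add: coord_op.rep_eq)

text \<open>Both compositions strip \<open>i\<close> and \<open>j\<close> from the multiset; they
  differ only in whether \<open>twist i j\<close> or \<open>twist j i\<close> is counted.\<close>

lemma coord_op_commute:
  assumes "r \<noteq> 0"
  shows "coord_op r i * coord_op r j = scalar_op (r powi (twist i j - twist j i)) * (coord_op r j
      * coord_op r i)"
proof (rule lin_op_eqI)
  fix v M
  show "app (coord_op r i * coord_op r j) v M = app (scalar_op (r powi (twist i j - twist j i)) *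
      (coord_op r j * coord_op r i)) v M"
  proof (cases "{#i, j#} \<subseteq># M")
    case True
    then obtain L where "M = {#i, j#} + L"
      by (auto simp: mset_subset_eq_exists_conv)
    then have M: "M = add_mset i (add_mset j L)"
      by simp
    have "app (coord_op r i * coord_op r j) v M = r powi (\<Sum>k\<in>#add_mset j L. twist i k)
        * (r powi (\<Sum>k\<in>#L. twist j k) * v L)"
      unfolding M app_simps coord_op_add ..
    moreover have "app (coord_op r j * coord_op r i) v M = r powi (\<Sum>k\<in>#add_mset i L. twist j k)
        * (r powi (\<Sum>k\<in>#L. twist i k) * v L)"
      unfolding M app_simps add_mset_commute[of i j] coord_op_add ..
    ultimately show ?thesis
      using assms by (simp add: app_simps scalar_op.rep_eq power_int_add power_int_diff)
  next
    case False
    have 0: "app (coord_op r a * coord_op r b) v M = 0" if "\<not> {#a, b#} \<subseteq># M" for a b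
    proof (cases "a \<in># M")
      case True
      then obtain L where M: "M = add_mset a L"
        by (metis mset_add)
      with that have "b \<notin># L"
        by simp
      then show ?thesis
        unfolding M app_simps coord_op_add by (simp add: coord_op_notin)
    qed (simp add: app_simps coord_op_notin)
    show ?thesis
      using 0[of i j] 0[of j i] False
      by (simp add: app_simps scalar_op.rep_eq add_mset_commute)
  qed
qed

text \<open>In the last relation, \<open>c\<close> commutes with \<open>b\<close>, while the
  commutators of \<open>b\<close> with \<open>s\<close> and with \<open>t\<close> are
  \<open>- (1 - p) * aa\<close> and \<open>(1 - p) * dd\<close>. The others are reorderings of
  q-commuting factors.\<close>

lemma site_relations:
  fixes p p' b c s t :: "'a::ring_1"
  assumes p: "\<And>x. x * p = p * x" and p': "\<And>x. x * p' = p' * x" and pp': "p * p' = 1"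
    and comm: "b * s = p * (s * b)" "t * b = p * (b * t)" "b * c = c * b"
      "s * t = p * (p * (t * s))" "s * c = p * (c * s)" "c * t = p * (t * c)"
  defines "aa \<equiv> s * b" and "cc \<equiv> c + s + t" and "dd \<equiv> b * t"
  shows "b * aa = p * (aa * b)" "dd * b = p * (b * dd)" "aa * cc = p * (cc * aa)"
    "cc * dd = p * (dd * cc)" "dd * aa = aa * dd" "b * cc - cc * b = (1 - p) * (dd - aa)"
proof -
  have left: "x * (y * z) = r * (y * (x * z))" if "x * y = r * (y * x)" for x y z r :: 'a
    by (simp add: mult.assoc[symmetric] that)
  have left1: "x * (y * z) = y * (x * z)" if "x * y = y * x" for x y z :: 'a
    by (simp add: mult.assoc[symmetric] that)
  have cancel: "p * (p' * x) = x" "p' * (p * x) = x" for x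
    by (simp_all add: mult.assoc[symmetric] pp' p[of p', symmetric] p[of p'])
  have tc: "t * c = p' * (c * t)" and ts: "t * s = (p' * p') * (s * t)"
    by (simp_all add: comm cancel mult.assoc)
  note nf = comm(1,2,3,5) tc ts comm(1,2,5)[THEN left] comm(3)[THEN left1] tc[THEN left]
    ts[THEN left]
    p[of b] p[of c] p[of s] p[of t] left1[OF p[of b]] left1[OF p[of c]]
    left1[OF p[of s]] left1[OF p[of t]] p'[of b] p'[of c] p'[of s] p'[of t] left1[OF p'[of b]]
    left1[OF p'[of c]] left1[OF p'[of s]] left1[OF p'[of t]] cancel
  show "b * aa = p * (aa * b)" "dd * b = p * (b * dd)" "aa * cc = p * (cc * aa)"
    "cc * dd = p * (dd * cc)" "dd * aa = aa * dd" "b * cc - cc * b = (1 - p) * (dd - aa)"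
    by (simp_all add: aa_def cc_def dd_def nf algebra_simps)
qed

section \<open>Leading monomials\<close>

context
  fixes r :: "'k::field"
  assumes r: "r \<noteq> 0"
begin

text \<open>\<open>m\<close> is the total charge of \<open>y\<close>, measured by commutation with
  the sites from \<open>n\<close> on. This is what the induction over the factors has to remember
  about the solution built so far.\<close>

definition homogeneous :: "nat \<Rightarrow> int \<Rightarrow> (coord multiset, 'k) lin_op \<Rightarrow> bool"
  where "homogeneous n m y \<longleftrightarrow>
    (\<forall>j. n \<le> site_of j \<longrightarrow> y * coord_op r j = scalar_op (r powi (m * charge j)) * (coord_op r j * y))"

lemma homogeneous_mono: "homogeneous n m y \<Longrightarrow> n \<le> n' \<Longrightarrow> homogeneous n' m y"
  by (auto simp: homogeneous_def)

lemma homogeneous_0: "homogeneous n m 0"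
  by (simp add: homogeneous_def)

lemma homogeneous_1: "homogeneous n 0 1"
  by (simp add: homogeneous_def scalar_op_simps)

lemma homogeneous_coord_op: "site_of i < n \<Longrightarrow> homogeneous n (charge i) (coord_op r i)"
  by (simp add: homogeneous_def coord_op_commute[OF r, of i] twist_def)

lemma homogeneous_add: "homogeneous n m x \<Longrightarrow> homogeneous n m y \<Longrightarrow> homogeneous n m (x + y)"
  by (simp add: homogeneous_def distrib_left distrib_right)

lemma homogeneous_mult:
  assumes "homogeneous n m x" "homogeneous n l y"
  shows "homogeneous n (m + l) (x * y)"
  unfolding homogeneous_def
proof (intro allI impI)
  fix j assume j: "n \<le> site_of j"
  have "x * y * coord_op r j = x * scalar_op (r powi (l * charge j)) * (coord_op r j * y)"
    using assms(2) j by (simp add: homogeneous_def mult.assoc)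
  also have "\<dots> = scalar_op (r powi (l * charge j)) * ((x * coord_op r j) * y)"
    by (simp add: scalar_op_central mult.assoc)
  also have "\<dots> = scalar_op (r powi (l * charge j)) * scalar_op (r powi (m * charge j)) * (coord_op
      r j * (x * y))"
    using assms(1) j by (simp add: homogeneous_def mult.assoc)
  also have "scalar_op (r powi (l * charge j)) * scalar_op (r powi (m * charge j))
      = (scalar_op (r powi ((m + l) * charge j)) :: (coord multiset, 'k) lin_op)"
    using r by (simp add: scalar_op_simps(5)[symmetric] power_int_add[symmetric] algebra_simps)
  finally show "x * y * coord_op r j = scalar_op (r powi ((m + l) * charge j)) * (coord_op r j *
      (x * y))" .
qed

lemma homogeneous_shift: "(\<And>k. homogeneous n m (f k)) \<Longrightarrow> homogeneous n m (shift f k)"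
  by (cases k) (simp_all add: homogeneous_0)

end

text \<open>Weights fall with the site, so that leading terms use the earliest sites available. The
  extra -1 ranks \<open>XC n\<close> above \<open>XS n\<close> and \<open>XT n\<close>, which makes
  it the leading term of c_n.\<close>

primrec weight1 :: "coord \<Rightarrow> int" where
  "weight1 (XB n) = - 2 * int n" | "weight1 (XC n) = - 2 * int n"
| "weight1 (XS n) = - 2 * int n - 1" | "weight1 (XT n) = - 2 * int n - 1"

definition weight :: "coord multiset \<Rightarrow> int"
  where "weight M = (\<Sum>i\<in>#M. weight1 i)"

lemma weight_simps [simp]:
  "weight {#} = 0" "weight (add_mset i M) = weight1 i + weight M" "weight (M + N) = weight M +
      weight N"
  by (simp_all add: weight_def)

text \<open>Different monomials may have the same weight; only ties at the top are excluded. This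
  replaces a total order on the monomials.\<close>

definition unique_top :: "(coord multiset \<Rightarrow> 'k::zero) \<Rightarrow> coord multiset \<Rightarrow> bool"
  where "unique_top v M \<longleftrightarrow> v M \<noteq> 0 \<and> (\<forall>L. v L \<noteq> 0 \<longrightarrow> L \<noteq> M \<longrightarrow> weight L < weight M)"

text \<open>Describing the leading exponent through the action on vectors makes multiplicativity a
  matter of composition, without normal forms for operators.\<close>

definition lead :: "(coord multiset, 'k::field) lin_op \<Rightarrow> coord multiset \<Rightarrow> bool"
  where "lead f E \<longleftrightarrow> (\<forall>v M. unique_top v M \<longrightarrow> unique_top (app f v) (E + M))"

definition below :: "(coord multiset, 'k::field) lin_op \<Rightarrow> int \<Rightarrow> bool"
  where "below f n \<longleftrightarrow> (\<forall>v M L. unique_top v M \<longrightarrow> app f v L \<noteq> 0 \<longrightarrow> weight L < n + weight M)"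

lemma lead_one: "lead 1 {#}"
  by (simp add: lead_def app_simps)

lemma lead_mult: "lead f E \<Longrightarrow> lead g F \<Longrightarrow> lead (f * g) (E + F)"
  by (simp add: lead_def app_simps add.assoc)

lemma below_zero: "below 0 n"
  by (simp add: below_def app_simps)

lemma below_add: "below f n \<Longrightarrow> below g n \<Longrightarrow> below (f + g) n"
  unfolding below_def app_simps by (metis add.left_neutral)

lemma lead_below: "lead f E \<Longrightarrow> weight E < n \<Longrightarrow> below f n"
  unfolding lead_def below_def unique_top_def by (smt (verit) weight_simps(3))

lemma lead_add:
  assumes "lead f E" "below g (weight E)"
  shows "lead (f + g) E"
  unfolding lead_def
proof (intro allI impI)
  fix v :: "coord multiset \<Rightarrow> 'a" and M assume v: "unique_top v M"
  have f: "unique_top (app f v) (E + M)" and g: "app g v L \<noteq> 0 \<Longrightarrow> weight L < weight (E + M)" for L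
    using assms v by (auto simp: lead_def below_def)
  then have "app g v (E + M) = 0"
    by fastforce
  with f g show "unique_top (app (f + g) v) (E + M)"
    unfolding unique_top_def app_simps by (metis add.right_neutral add.left_neutral)
qed

lemma lead_coord_op:
  assumes "r \<noteq> 0" shows "lead (coord_op r i) {#i#}"
  unfolding lead_def
proof (intro allI impI)
  fix v :: "coord multiset \<Rightarrow> 'a" and M assume v: "unique_top v M"
  show "unique_top (app (coord_op r i) v) ({#i#} + M)"
    unfolding unique_top_def
  proof (intro conjI allI impI)
    show "app (coord_op r i) v ({#i#} + M) \<noteq> 0"
      using v assms by (simp add: coord_op_add unique_top_def)
    fix L assume L: "app (coord_op r i) v L \<noteq> 0" "L \<noteq> {#i#} + M"
    then obtain L' where "L = add_mset i L'"
      by (metis coord_op_notin mset_add)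
    with L v show "weight L < weight ({#i#} + M)"
      by (auto simp: coord_op_add unique_top_def)
  qed
qed

text \<open>The exponent of the product of a_i = s_i b_i over the first \<open>k\<close> sites,
  which turns out to be the leading term of \<open>G k\<close>. Likewise \<open>exp_H\<close>
  belongs to the product of the d_i = b_i s'_i.\<close>

primrec exp_G :: "nat \<Rightarrow> coord multiset" where
  "exp_G 0 = {#}" | "exp_G (Suc k) = {#XS k, XB k#} + exp_G k"

primrec exp_H :: "nat \<Rightarrow> coord multiset" where
  "exp_H 0 = {#}" | "exp_H (Suc k) = {#XB k, XT k#} + exp_H k"

definition exp_W :: "nat \<Rightarrow> coord multiset"
  where "exp_W k = {#XB k#} + exp_G k"

definition exp_V :: "nat \<Rightarrow> coord multiset"
  where "exp_V k = {#XC k#} + exp_H k"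

text \<open>After n factors, \<open>W\<close> and \<open>V\<close> have n possibly nonzero
  coefficients and \<open>G\<close> and \<open>H\<close> have n + 1. This accounts for the bounds
  \<open>n\<close> and \<open>Suc n\<close> in what follows.\<close>

definition leads ::
    "nat \<Rightarrow> (nat \<Rightarrow> (coord multiset, 'k::field) lin_op) \<Rightarrow> (nat \<Rightarrow> coord multiset) \<Rightarrow> bool"
  where "leads n f E \<longleftrightarrow> (\<forall>k<n. lead (f k) (E k)) \<and> (\<forall>k\<ge>n. f k = 0)"

text \<open>For \<open>k \<le> n\<close> the old coefficient keeps the lead, since the new site is
  too light. For \<open>k = Suc n\<close> the old \<open>G k\<close> and \<open>shift W k\<close>
  vanish and \<open>a * G n\<close> leads. With \<open>d\<close>, \<open>b\<close>,
  \<open>V\<close>, \<open>H\<close> for \<open>a\<close>, \<open>c\<close>, \<open>W\<close>,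
  \<open>G\<close> the lemma serves \<open>H\<close> as well.\<close>

lemma leads_step_G:
  assumes leads: "leads (Suc n) G EG" "leads n W EW"
    and ac: "lead a A" "lead c C" "weight A = - 4 * int n - 1" "weight C = - 2 * int n"
    and EG: "\<And>k. weight (EG (Suc k)) = weight (EG k) - 4 * int k - 1" "EG (Suc n) = A + EG n"
    and EW: "\<And>k. weight (EW k) = weight (EG k) - 2 * int k"
  shows "leads (Suc (Suc n)) (\<lambda>k. G k + a * shift G k + c * shift W k) EG"
  unfolding leads_def
proof (intro conjI allI impI)
  fix k assume "k < Suc (Suc n)"
  then consider "k = 0" | j where "k = Suc j" "j < n" | "k = Suc n"
    by (metis less_Suc_eq old.nat.exhaust Suc_less_eq)
  then show "lead (G k + a * shift G k + c * shift W k) (EG k)"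
  proof cases
    case (2 j)
    have "below (a * G j) (weight (EG k))"
      by (rule lead_below[OF lead_mult[OF ac(1), where F = "EG j"]])
        (use leads(1) 2 ac EG in \<open>auto simp: leads_def\<close>)
    moreover have "below (c * W j) (weight (EG k))"
      by (rule lead_below[OF lead_mult[OF ac(2), where F = "EW j"]])
        (use leads(2) 2 ac EG EW in \<open>auto simp: leads_def\<close>)
    ultimately show ?thesis
      using leads(1) 2 unfolding add.assoc
      by (intro lead_add below_add) (auto simp: leads_def)
  next
    case 3
    then show ?thesis
      using leads lead_mult[OF ac(1), of "G n" "EG n"] EG(2) by (simp add: leads_def)
  qed (use leads in \<open>auto simp: leads_def\<close>)
next
  fix k assume "k \<ge> Suc (Suc n)"
  then show "G k + a * shift G k + c * shift W k = 0"
    using leads by (cases k) (auto simp: leads_def)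
qed

text \<open>At \<open>k = n\<close> the old coefficient is zero and \<open>b * G n\<close> takes the
  lead. For smaller \<open>k\<close> the top of \<open>b * G k\<close> lies 2 (n - k) below
  \<open>EW k\<close>, so the old term still leads.\<close>

lemma leads_step_W:
  assumes leads: "leads (Suc n) G EG" "leads n W EW"
    and bd: "lead b B" "lead d D" "weight B = - 2 * int n" "weight D = - 4 * int n - 1"
    and EG: "\<And>k. weight (EG (Suc k)) = weight (EG k) - 4 * int k - 1"
    and EW: "\<And>k. weight (EW k) = weight (EG k) - 2 * int k" "EW n = B + EG n"
  shows "leads (Suc n) (\<lambda>k. W k + b * G k + d * shift W k) EW"
  unfolding leads_def
proof (intro conjI allI impI)
  fix k assume k: "k < Suc n"
  have d: "below (d * shift W k) (weight (EW k))"
  proof (cases k)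
    case (Suc j)
    show ?thesis
      unfolding Suc shift_simps
      by (rule lead_below[OF lead_mult[OF bd(2), where F = "EW j"]])
        (use leads(2) Suc bd EG EW k in \<open>auto simp: leads_def\<close>)
  qed (simp add: below_zero)
  show "lead (W k + b * G k + d * shift W k) (EW k)"
  proof (cases "k = n")
    case True
    have "lead (b * G k) (EW k)"
      unfolding True EW(2) using leads by (intro lead_mult bd) (auto simp: leads_def)
    with d True show ?thesis
      using leads(2) by (auto simp: leads_def intro: lead_add)
  next
    case False
    have "below (b * G k) (weight (EW k))"
      by (rule lead_below[OF lead_mult[OF bd(1), where F = "EG k"]])
        (use leads(1) bd EG EW k False in \<open>auto simp: leads_def\<close>)
    with d show ?thesis
      using leads(2) k False unfolding add.assoc
      by (intro lead_add below_add) (auto simp: leads_def)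
  qed
next
  fix k assume "k \<ge> Suc n"
  then show "W k + b * G k + d * shift W k = 0"
    using leads by (cases k) (auto simp: leads_def)
qed

text \<open>The solution is a product of \<open>n\<close> elementary matrices, one per site.
  Finitely many factors suffice because a single linear relation involves only finitely many
  generators.\<close>

theorem model:
  fixes r :: "'k::field"
  assumes r: "r \<noteq> 0" "r \<noteq> 1"
  obtains W V G H :: "nat \<Rightarrow> (coord multiset, 'k) lin_op"
  where "alternating {0} (scalar_op (inverse r)) (scalar_op r) (scalar_op (inverse (1 - inverse
      r))) W V G H"
    "leads n W exp_W" "leads n V exp_V" "leads (Suc n) G exp_G" "leads (Suc n) H exp_H"
proof -
  let ?p = "scalar_op (inverse r) :: (coord multiset, 'k) lin_op"
  let ?p' = "scalar_op r :: (coord multiset, 'k) lin_op"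
  let ?u = "scalar_op (inverse (1 - inverse r)) :: (coord multiset, 'k) lin_op"
  note hom = homogeneous_def[OF r(1)]
  have pp': "?p * ?p' = 1"
    using r by (simp add: scalar_op_simps(5)[symmetric]) (simp add: scalar_op_simps)
  have "\<exists>W V G H. alternating {0} ?p ?p' ?u W V G H \<and>
    (leads n W exp_W \<and> leads n V exp_V \<and> leads (Suc n) G exp_G \<and> leads (Suc n) H exp_H) \<and>
    (\<forall>k. homogeneous r n 1 (W k) \<and> homogeneous r n (-1) (V k) \<and> homogeneous r n 0 (G k) \<and>
      homogeneous r n 0 (H k))"
  proof (induction n)
    case 0
    \<comment> \<open>The empty product is the identity matrix.\<close>
    let ?G = "\<lambda>k. if k = 0 then 1 else 0 :: (coord multiset, 'k) lin_op"
    have "alternating {0} ?p ?p' ?u (\<lambda>_. 0) (\<lambda>_. 0) ?G ?G"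
    proof
      show "?p * ?p' = 1"
        by (rule pp')
      show "?u * (1 - ?p) = 1"
        using r by (simp add: scalar_op_simps(2,4,5)[symmetric])
      show "x * ?p = ?p * x" "x * ?p' = ?p' * x" for x
        by (rule scalar_op_central)+
    qed (auto simp: bracket_def qbracket_def)
    moreover have "leads 0 (\<lambda>_. 0 :: (coord multiset, 'k) lin_op) E" for E
      by (simp add: leads_def)
    moreover have "leads (Suc 0) ?G exp_G" "leads (Suc 0) ?G exp_H"
      by (simp_all add: leads_def lead_one)
    ultimately show ?case
      using homogeneous_0[OF r(1)] homogeneous_1[OF r(1)]
      by (intro exI[of _ "\<lambda>_. 0"] exI[of _ ?G]) auto
  next
    case (Suc n)
    then obtain W V G H where alt: "alternating {0} ?p ?p' ?u W V G H"
      and leads: "leads n W exp_W" "leads n V exp_V" "leads (Suc n) G exp_G" "leads (Suc n) H exp_H"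
      and hom0: "\<And>k. homogeneous r n 1 (W k)" "\<And>k. homogeneous r n (-1) (V k)"
        "\<And>k. homogeneous r n 0 (G k)" "\<And>k. homogeneous r n 0 (H k)"
      by blast
    define b where "b = coord_op r (XB n)"
    define a where "a = coord_op r (XS n) * coord_op r (XB n)"
    define c where "c = coord_op r (XC n) + coord_op r (XS n) + coord_op r (XT n)"
    define d where "d = coord_op r (XB n) * coord_op r (XT n)"
    note defs = a_def b_def c_def d_def
    have com: "y * coord_op r j = scalar_op (r powi (m * charge j)) * (coord_op r j * y)"
      if "homogeneous r n m y" "site_of j = n" for y m j
      using that by (simp add: hom)
    have com_W: "W k * coord_op r j = scalar_op (r powi charge j) * (coord_op r j * W k)"
      and com_V: "V k * coord_op r j = scalar_op (r powi - charge j) * (coord_op r j * V k)"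
      and com_G: "G k * coord_op r j = coord_op r j * G k" and com_H: "H k * coord_op r j =
          coord_op r j * H k"
      if "site_of j = n" for k j
      using com[OF hom0(1) that] com[OF hom0(2) that] com[OF hom0(3) that] com[OF hom0(4) that]
      by (simp_all add: scalar_op_simps)
    \<comment> \<open>\<open>a\<close> and \<open>d\<close> are products of two coordinates of
      opposite charge, so the two powers of \<open>r\<close> cancel.\<close>
    have pair: "y * (coord_op r i * coord_op r j) = coord_op r i * coord_op r j * y"
      if "homogeneous r n m y" "site_of i = n" "site_of j = n" "charge j = - charge i" for y m i j
    proof -
      have "y * (coord_op r i * coord_op r j) = scalar_op (r powi (m * charge i)) * (coord_op r i
          * (y * coord_op r j))"
        by (simp add: mult.assoc[symmetric] com[OF that(1,2)])
      also have "\<dots> = scalar_op (r powi (m * charge i))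
          * (scalar_op (r powi (m * charge j)) * (coord_op r i * (coord_op r j * y)))"
        by (simp add: com[OF that(1,3)] mult.assoc[symmetric] scalar_op_central[of "coord_op r i"])
      also have "\<dots> = coord_op r i * coord_op r j * y"
        using r by (simp add: mult.assoc[symmetric] scalar_op_simps(2) scalar_op_simps(5)[symmetric]
            power_int_add[symmetric] that(4))
      finally show ?thesis .
    qed
    have comm: "coord_op r (XB n) * coord_op r (XS n) = ?p * (coord_op r (XS n) * coord_op r (XB
        n))"
      "coord_op r (XT n) * coord_op r (XB n) = ?p * (coord_op r (XB n) * coord_op r (XT n))"
      "coord_op r (XB n) * coord_op r (XC n) = coord_op r (XC n) * coord_op r (XB n)"
      "coord_op r (XS n) * coord_op r (XT n) = ?p * (?p * (coord_op r (XT n) * coord_op r (XS n)))"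
      "coord_op r (XS n) * coord_op r (XC n) = ?p * (coord_op r (XC n) * coord_op r (XS n))"
      "coord_op r (XC n) * coord_op r (XT n) = ?p * (coord_op r (XT n) * coord_op r (XC n))"
      using coord_op_commute[OF r(1), of "XB n" "XS n"] coord_op_commute[OF r(1), of "XT n" "XB n"]
        coord_op_commute[OF r(1), of "XB n" "XC n"] coord_op_commute[OF r(1), of "XS n" "XT n"]
        coord_op_commute[OF r(1), of "XS n" "XC n"] coord_op_commute[OF r(1), of "XC n" "XT n"]
      by (simp_all add: twist_def power_int_minus scalar_op_simps power2_eq_square mult.assoc)
    have site: "b * a = ?p * (a * b)" "d * b = ?p * (b * d)" "a * c = ?p * (c * a)"
        "c * d = ?p * (d * c)" "d * a = a * d" "b * c - c * b = (1 - ?p) * (d - a)"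
      unfolding defs by (rule site_relations[OF scalar_op_central scalar_op_central pp' comm])+
    interpret alternating_step ?p ?p' ?u W V G H a b c d
    proof (intro alternating_step.intro alt alternating_step_axioms.intro site)
      fix k
      show "W k * b = ?p' * (b * W k)" "V k * b = ?p * (b * V k)" "G k * b = b * G k"
        "H k * b = b * H k"
        by (simp_all add: b_def com_W com_V com_G com_H power_int_minus)
      show "W k * c = ?p * (c * W k)" "V k * c = ?p' * (c * V k)" "G k * c = c * G k"
        "H k * c = c * H k"
        by (simp_all add: c_def com_W com_V com_G com_H power_int_minus distrib_left distrib_right)
      show "W k * a = a * W k" "V k * a = a * V k" "G k * a = a * G k" "H k * a = a * H k"
        "W k * d = d * W k" "V k * d = d * V k" "G k * d = d * G k" "H k * d = d * H k"
        unfolding a_def d_def by (rule hom0[THEN pair]; simp)+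
    qed
    have lead_ops: "lead a {#XS n, XB n#}" "lead b {#XB n#}" "lead d {#XB n, XT n#}"
      using lead_mult[OF lead_coord_op lead_coord_op] lead_coord_op r unfolding a_def b_def d_def
      by (fastforce simp: add_mset_commute)+
    have lead_c: "lead c {#XC n#}"
      unfolding c_def
      by (intro lead_add lead_coord_op lead_below[OF lead_coord_op] r) simp_all
    have "leads (Suc n) W' exp_W"
      unfolding W'_def[abs_def]
      by (rule leads_step_W[OF leads(3,1) lead_ops(2,3)]) (simp_all add: exp_W_def)
    moreover have "leads (Suc n) V' exp_V"
      unfolding V'_def[abs_def]
      by (rule leads_step_W[OF leads(4,2) lead_c lead_ops(1)]) (simp_all add: exp_V_def)
    moreover have "leads (Suc (Suc n)) G' exp_G"
      unfolding G'_def[abs_def]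
      by (rule leads_step_G[OF leads(3,1) lead_ops(1) lead_c]) (simp_all add: exp_W_def)
    moreover have "leads (Suc (Suc n)) H' exp_H"
      unfolding H'_def[abs_def]
      by (rule leads_step_G[OF leads(4,2) lead_ops(3,2)]) (simp_all add: exp_V_def)
    moreover have "homogeneous r (Suc n) 1 (W' k)" "homogeneous r (Suc n) (-1) (V' k)"
        "homogeneous r (Suc n) 0 (G' k)" "homogeneous r (Suc n) 0 (H' k)" for k
    proof -
      have coord_op: "homogeneous r (Suc n) (charge i) (coord_op r i)" if "site_of i = n" for i
        using homogeneous_coord_op[OF r(1)] that by simp
      have b: "homogeneous r (Suc n) 1 b"
        using coord_op[of "XB n"] by (simp add: b_def)
      have c: "homogeneous r (Suc n) (-1) c"
        using coord_op[of "XC n"] coord_op[of "XS n"] coord_op[of "XT n"] unfolding c_def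
        by (intro homogeneous_add[OF r(1)]) simp_all
      have a: "homogeneous r (Suc n) 0 a"
        using homogeneous_mult[OF r(1) coord_op[of "XS n"] coord_op[of "XB n"]] by (simp add: a_def)
      have d: "homogeneous r (Suc n) 0 d"
        using homogeneous_mult[OF r(1) coord_op[of "XB n"] coord_op[of "XT n"]] by (simp add: d_def)
      note old = hom0[THEN homogeneous_mono[OF r(1)], of "Suc n", simplified]
      note mult = homogeneous_mult[OF r(1)] and shift = homogeneous_shift[OF r(1)]
      show "homogeneous r (Suc n) 1 (W' k)"
        unfolding W'_def by (intro homogeneous_add[OF r(1)] old(1)
            mult[OF b old(3), simplified] mult[OF d shift[OF old(1)], simplified])
      show "homogeneous r (Suc n) (-1) (V' k)"
        unfolding V'_def by (intro homogeneous_add[OF r(1)] old(2)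
            mult[OF c old(4), simplified] mult[OF a shift[OF old(2)], simplified])
      show "homogeneous r (Suc n) 0 (G' k)"
        unfolding G'_def by (intro homogeneous_add[OF r(1)] old(3)
            mult[OF a shift[OF old(3)], simplified] mult[OF c shift[OF old(1)], simplified])
      show "homogeneous r (Suc n) 0 (H' k)"
        unfolding H'_def by (intro homogeneous_add[OF r(1)] old(4)
            mult[OF d shift[OF old(4)], simplified] mult[OF b shift[OF old(2)], simplified])
    qed
    ultimately show ?case
      using step by (intro exI[of _ W'] exI[of _ V'] exI[of _ G'] exI[of _ H']) simp
  qed
  then show ?thesis
    using that by blast
qed

section \<open>The spanning property\<close>

definition mon :: "'g list \<Rightarrow> ('g, 'k::field) free_algebra"
  where "mon w = Poly_Mapping.single (Word w) 1"

lemma mon_Nil: "mon [] = 1"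
  and mon_single: "mon [g] = gen g"
  and mon_append: "mon (u @ v) = mon u * mon v"
  by (simp_all add: mon_def gen_def mult_single zero_free_monoid_def[symmetric])

lemma mon_Cons: "mon (g # w) = gen g * mon w"
  using mon_append[of "[g]" w] by (simp add: mon_single)

lemma single_mon: "Poly_Mapping.single (Word w) c = scalar c * mon w"
  by (simp add: mon_def scalar_def mult_single zero_free_monoid_def)

lemma free_algebra_induct [case_names mon add]:
  assumes "\<And>c w. P (scalar c * mon w)" and "\<And>x y. P x \<Longrightarrow> P y \<Longrightarrow> P (x + y)"
  shows "P (x :: ('g, 'k::field) free_algebra)"
proof (induction x rule: Poly_Mapping.update_induct)
  case const
  show ?case
    using assms(1)[of 0] by (simp add: scalar_def)
next
  case (update f a b)
  have "Poly_Mapping.update a b f = Poly_Mapping.single a b + f"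
    using update(1)
    by (intro poly_mapping_eqI)
      (auto simp: lookup_update lookup_add lookup_single when_def in_keys_iff)
  moreover have "P (Poly_Mapping.single a b)"
    using assms(1) by (cases a) (simp add: single_mon)
  ultimately show ?case
    using assms(2) update(3) by simp
qed

section \<open>Ideals generated by relations, and their cosets\<close>

lemma relation_ideal_zero: "0 \<in> relation_ideal E"
  and relation_ideal_add: "x \<in> relation_ideal E \<Longrightarrow> y \<in> relation_ideal E \<Longrightarrow> x + y \<in> relation_ideal E"
  and relation_ideal_left: "x \<in> relation_ideal E \<Longrightarrow> z * x \<in> relation_ideal E"
  and relation_ideal_right: "x \<in> relation_ideal E \<Longrightarrow> x * z \<in> relation_ideal E"
proof -
  interpret ideal "relation_ideal E" class_ring
    by (rule ideal_relation_ideal)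
  show "0 \<in> relation_ideal E"
    using zero_closed by simp
  show "x \<in> relation_ideal E \<Longrightarrow> y \<in> relation_ideal E \<Longrightarrow> x + y \<in> relation_ideal E"
    using a_closed[of x y] by simp
  show "x \<in> relation_ideal E \<Longrightarrow> z * x \<in> relation_ideal E"
    using I_l_closed[of x z] by simp
  show "x \<in> relation_ideal E \<Longrightarrow> x * z \<in> relation_ideal E"
    using I_r_closed[of x z] by simp
qed

lemma relation_ideal_minus: "x \<in> relation_ideal E \<Longrightarrow> - x \<in> relation_ideal E"
  using relation_ideal_left[of x E "- 1"] by simp

lemma relation_ideal_diff:
  "x \<in> relation_ideal E \<Longrightarrow> y \<in> relation_ideal E \<Longrightarrow> x - y \<in> relation_ideal E"
  using relation_ideal_add[of x E "- y"] relation_ideal_minus[of y E] by simp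

lemma relation_ideal_incl: "(x, y) \<in> E \<Longrightarrow> x - y \<in> relation_ideal E"
  unfolding relation_ideal_def
  by (rule subsetD[OF ring.genideal_self[OF class_ring.ring_axioms]]) force+

text \<open>The kernel of \<open>f\<close> is a two-sided ideal that contains the
  generators.\<close>

lemma relation_ideal_minimal:
  fixes f :: "('g, 'k::field) free_algebra \<Rightarrow> 'b::ring_1"
  assumes add: "\<And>x y. f (x + y) = f x + f y" and mult: "\<And>x y. f (x * y) = f x * f y"
    and E: "\<And>x y. (x, y) \<in> E \<Longrightarrow> f (x - y) = 0" and x: "x \<in> relation_ideal E"
  shows "f x = 0"
proof -
  have zero: "f 0 = 0"
    using add[of 0 0] by simp
  have minus: "f (- x) = - f x" for x
    using add[of x "- x"] zero by (simp add: eq_neg_iff_add_eq_0 add.commute)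
  have "ideal {x. f x = 0} class_ring"
  proof (rule idealI)
    show "subgroup {x. f x = 0} (add_monoid class_ring)"
    proof (rule group.subgroupI)
      show group: "Group.group (add_monoid (class_ring :: ('g, 'k) free_algebra ring))"
        by (rule abelian_group.a_group[OF ring.is_abelian_group[OF class_ring.ring_axioms]])
      show "inv\<^bsub>add_monoid class_ring\<^esub> a \<in> {x. f x = 0}" if "a \<in> {x. f x = 0}" for a
        using group.inv_equality[OF group, of "- a" a] that by (simp add: minus)
    qed (use zero in \<open>auto simp: add\<close>)
  qed (auto simp: mult class_ring.ring_axioms)
  moreover have "(\<lambda>(x, y). x - y) ` E \<subseteq> {x. f x = 0}"
    by clarify (rule E)
  ultimately have "relation_ideal E \<subseteq> {x. f x = 0}"
    unfolding relation_ideal_def by (rule ring.genideal_minimal[OF class_ring.ring_axioms])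
  with x show ?thesis
    by blast
qed

lemma coset_image: "coset E z = (\<lambda>i. i + z) ` relation_ideal E"
  by (auto simp: coset_def a_r_coset_def')

lemma coset_eq_iff: "coset E x = coset E y \<longleftrightarrow> x - y \<in> relation_ideal E"
proof
  assume "coset E x = coset E y"
  moreover have "x \<in> coset E x"
    unfolding coset_image using relation_ideal_zero by force
  ultimately show "x - y \<in> relation_ideal E"
    unfolding coset_image by auto
next
  have sub: "coset E x \<subseteq> coset E y" if "x - y \<in> relation_ideal E" for x y
    unfolding coset_image
  proof clarify
    fix i assume "i \<in> relation_ideal E"
    then show "i + x \<in> (\<lambda>i. i + y) ` relation_ideal E"
      using relation_ideal_add[OF _ that, of i] by (intro image_eqI[of _ _ "i + (x - y)"]) auto
  qed
  assume "x - y \<in> relation_ideal E"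
  then show "coset E x = coset E y"
    using sub[of x y] sub[of y x] relation_ideal_minus[of "x - y" E] by auto
qed

definition G_seq :: "nat \<Rightarrow> (alt_gen, 'k::field) free_algebra"
  where "G_seq k = (case k of 0 \<Rightarrow> 1 | Suc j \<Rightarrow> Gp j)"

definition H_seq :: "nat \<Rightarrow> (alt_gen, 'k::field) free_algebra"
  where "H_seq k = (case k of 0 \<Rightarrow> 1 | Suc j \<Rightarrow> Gt j)"

lemma seq_simps [simp]: "G_seq 0 = 1" "G_seq (Suc k) = Gp k" "H_seq 0 = 1" "H_seq (Suc k) = Gt k"
  by (simp_all add: G_seq_def H_seq_def)

lemma scalar_diff: "scalar (a - b) = scalar a - scalar b"
  by (simp add: scalar_def single_diff)

lemma qcomm_normalize:
  assumes "q \<noteq> 0"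
  shows "qbracket (scalar (inverse q ^ 2)) x y - (1 - scalar (inverse q ^ 2)) * z
    = scalar (inverse q) * (qcomm q x y - scalar (q - inverse q) * z)"
proof -
  have "scalar (inverse q) * (scalar (q - inverse q) * z) = (1 - scalar (inverse q ^ 2)) * z"
    using assms by (simp add: mult.assoc[symmetric] scalar_simps(2)[symmetric] right_diff_distrib
        power2_eq_square scalar_diff scalar_simps(3))
  moreover have "scalar (inverse q) * qcomm q x y = qbracket (scalar (inverse q ^ 2)) x y"
    using assms by (simp add: qcomm_def qbracket_def right_diff_distrib mult.assoc[symmetric]
        scalar_simps(2)[symmetric] power2_eq_square scalar_simps(3))
  ultimately show ?thesis
    by (simp add: right_diff_distrib)
qed

abbreviation alt_ideal :: "'k::field \<Rightarrow> (alt_gen, 'k) free_algebra set"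
  where "alt_ideal q \<equiv> relation_ideal (alt_relations q)"

text \<open>The rank of each of the four families in the prescribed order. Letters of equal rank
  commute modulo the ideal.\<close>

primrec gen_type :: "alt_gen \<Rightarrow> nat" where
  "gen_type (G_plain k) = 0" | "gen_type (W_neg k) = 1" | "gen_type (W_pos k) = 2" | "gen_type
      (G_tilde k) = 3"

context
  fixes q :: "'k::field"
  assumes q: "q \<noteq> 0" "q ^ 2 \<noteq> 1"
begin

lemma
  shows qcomm_relation: "(qcomm q x y, scalar (q - inverse q) * z) \<in> alt_relations q \<Longrightarrow>
      qbracket (scalar (inverse q ^ 2)) x y - (1 - scalar (inverse q ^ 2)) * z \<in> alt_ideal q"
    and comm_relation: "(comm x y, 0) \<in> alt_relations q \<Longrightarrow> bracket x y \<in> alt_ideal q"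
    and comm_comm_relation: "(comm x y + comm z w, 0) \<in> alt_relations q \<Longrightarrow> bracket x y - bracket w
        z \<in> alt_ideal q"
proof -
  assume "(qcomm q x y, scalar (q - inverse q) * z) \<in> alt_relations q"
  from relation_ideal_left[OF relation_ideal_incl[OF this]]
  show "qbracket (scalar (inverse q ^ 2)) x y - (1 - scalar (inverse q ^ 2)) * z \<in> alt_ideal q"
    by (simp add: qcomm_normalize[OF q(1)])
next
  assume "(comm x y, 0) \<in> alt_relations q"
  from relation_ideal_incl[OF this] show "bracket x y \<in> alt_ideal q"
    by (simp add: comm_def bracket_def)
next
  assume "(comm x y + comm z w, 0) \<in> alt_relations q"
  from relation_ideal_incl[OF this] show "bracket x y - bracket w z \<in> alt_ideal q"
    by (simp add: comm_def bracket_def algebra_simps)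
qed

lemma alternating_free:
  "alternating (alt_ideal q) (scalar (inverse q ^ 2)) (scalar (q ^ 2)) (scalar (inverse (1 -
      inverse q ^ 2)))
    Wn Wp G_seq H_seq"
proof
  show "scalar (inverse q ^ 2) * scalar (q ^ 2) = 1"
    using q by (simp add: scalar_simps(2)[symmetric] scalar_simps(3) power_mult_distrib[symmetric])
  have "1 - inverse q ^ 2 \<noteq> 0"
    using q by (auto simp: power_inverse)
  from left_inverse[OF this]
  have "scalar (inverse (1 - inverse q ^ 2)) * scalar (1 - inverse q ^ 2) = 1"
    by (simp only: scalar_simps(2)[symmetric] scalar_simps(3))
  then show "scalar (inverse (1 - inverse q ^ 2)) * (1 - scalar (inverse q ^ 2)) = 1"
    by (simp add: scalar_diff scalar_simps(3))
  fix k l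
  show "bracket (Wn 0) (Wp k) - (1 - scalar (inverse q ^ 2)) * (H_seq (Suc k) - G_seq (Suc k)) \<in>
      alt_ideal q"
    using relation_ideal_incl[OF alt_relations.intros(1)[of k q]]
    by (simp add: bracket_def comm_def scalar_diff scalar_simps(3))
  show "bracket (Wp 0) (Wn k) - (1 - scalar (inverse q ^ 2)) * (G_seq (Suc k) - H_seq (Suc k)) \<in>
      alt_ideal q"
    using relation_ideal_minus[OF relation_ideal_incl[OF alt_relations.intros(2)[of k q]]]
    by (simp add: bracket_def comm_def scalar_diff scalar_simps(3) algebra_simps)
  \<comment> \<open>The case of index zero, where \<open>G_seq\<close> and \<open>H_seq\<close> are
    1; it is not among the defining relations.\<close>
  have trivial: "qbracket p 1 x - (1 - p) * x \<in> alt_ideal q" "qbracket p x 1 - (1 - p) * x \<in>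
      alt_ideal q" for p x
    by (simp_all add: qbracket_def left_diff_distrib relation_ideal_zero)
  show "qbracket (scalar (inverse q ^ 2)) (Wn 0) (G_seq k) - (1 - scalar (inverse q ^ 2)) * Wn k \<in>
      alt_ideal q"
    "qbracket (scalar (inverse q ^ 2)) (H_seq k) (Wn 0) - (1 - scalar (inverse q ^ 2)) * Wn k \<in>
        alt_ideal q"
    "qbracket (scalar (inverse q ^ 2)) (Wp 0) (H_seq k) - (1 - scalar (inverse q ^ 2)) * Wp k \<in>
        alt_ideal q"
    "qbracket (scalar (inverse q ^ 2)) (G_seq k) (Wp 0) - (1 - scalar (inverse q ^ 2)) * Wp k \<in>
        alt_ideal q"
    by (cases k; simp only: seq_simps trivial; intro qcomm_relation alt_relations.intros)+
  show "bracket (G_seq k) (G_seq l) \<in> alt_ideal q" "bracket (H_seq k) (H_seq l) \<in> alt_ideal q"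
    by (cases k; cases l; simp add: relation_ideal_zero;
        intro comm_relation alt_relations.intros)+
  show "bracket (H_seq k) (G_seq l) - bracket (H_seq l) (G_seq k) \<in> alt_ideal q"
    by (cases k; cases l; simp add: relation_ideal_zero;
        intro comm_comm_relation alt_relations.intros)
  show "bracket (Wn k) (Wn l) \<in> alt_ideal q" "bracket (Wp k) (Wp l) \<in> alt_ideal q"
    by (intro comm_relation alt_relations.intros)+
  show "bracket (Wn k) (Wp l) - bracket (Wn l) (Wp k) \<in> alt_ideal q"
    "bracket (Wn k) (G_seq (Suc l)) - bracket (Wn l) (G_seq (Suc k)) \<in> alt_ideal q"
    "bracket (Wn k) (H_seq (Suc l)) - bracket (Wn l) (H_seq (Suc k)) \<in> alt_ideal q"
    "bracket (Wp k) (H_seq (Suc l)) - bracket (Wp l) (H_seq (Suc k)) \<in> alt_ideal q"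
    "bracket (Wp k) (G_seq (Suc l)) - bracket (Wp l) (G_seq (Suc k)) \<in> alt_ideal q"
    unfolding seq_simps by (intro comm_comm_relation alt_relations.intros)+
qed (auto intro: relation_ideal_zero relation_ideal_diff relation_ideal_left relation_ideal_right
    scalar_commute)

lemma same_type_commute: "gen_type x = gen_type y \<Longrightarrow> mon [x, y] - mon [y, x] \<in> alt_ideal q"
  using comm_relation[OF alt_relations.intros(7)] comm_relation[OF alt_relations.intros(8)]
    comm_relation[OF alt_relations.intros(14)] comm_relation[OF alt_relations.intros(15)]
  by (cases x; cases y) (simp_all add: mon_Cons mon_Nil bracket_def)

text \<open>A pair counts as smaller if its first letter has smaller type, whatever the second
  letter is. The six kinds of inverted pairs are covered by the straightening lemmas for
  \<open>F\<close> and for its mirror image \<open>S\<close>.\<close>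

lemma straighten_pair:
  assumes N: "\<And>x y. x \<in> N \<Longrightarrow> y \<in> N \<Longrightarrow> x - y \<in> N" "\<And>c x. x \<in> N \<Longrightarrow> scalar c * x \<in> N" "alt_ideal q \<subseteq> N"
    and short: "\<And>w. length w \<le> 1 \<Longrightarrow> mon w \<in> N"
    and small: "\<And>x' y'. gen_type x' < gen_type x \<Longrightarrow> mon [x', y'] \<in> N"
    and inverted: "gen_type y < gen_type x"
  shows "mon [x, y] \<in> N"
proof -
  let ?p = "scalar (inverse q ^ 2)" and ?p' = "scalar (q ^ 2)"
    and ?u = "scalar (inverse (1 - inverse q ^ 2))"
  interpret F: alternating_filter "alt_ideal q" ?p ?p' ?u Wn Wp G_seq H_seq N
    by (intro alternating_filter.intro alternating_free alternating_filter_axioms.intro)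
      (use N in auto)
  interpret S: alternating_filter "alt_ideal q" ?p ?p' ?u Wp Wn H_seq G_seq N
    by (rule F.swap_filter)
  have single: "gen g \<in> N" for g
    using short[of "[g]"] by (simp add: mon_single)
  have one: "1 \<in> N"
    using short[of "[]"] by (simp add: mon_Nil)
  have seq: "G_seq k \<in> N" "H_seq k \<in> N" for k
    by (cases k; simp add: single one)+
  have pair: "gen x' * gen y' \<in> N" if "gen_type x' < gen_type x" for x' y'
    using small[OF that, of y'] by (simp add: mon_Cons mon_Nil)
  have G: "G_seq k * gen g \<in> N" "G_seq k * H_seq l \<in> N" if "0 < gen_type x" for k l g
    using that by (cases k; cases l; simp add: single pair one)+
  have W: "Wn k * H_seq l \<in> N" if "1 < gen_type x" for k l
    using that by (cases l; simp add: single pair)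
  have V: "Wp k * H_seq l \<in> N" if "2 < gen_type x" for k l
    using that by (cases l; simp add: single pair)
  have "gen x * gen y \<in> N"
  proof (cases x)
    case (W_neg k)
    with inverted obtain l where "y = G_plain l"
      by (cases y) auto
    then show ?thesis
      using F.straighten_WG[of k "Suc l"] W_neg G single by simp
  next
    case (W_pos k)
    with inverted consider l where "y = G_plain l" | l where "y = W_neg l"
      by (cases y) auto
    then show ?thesis
    proof cases
      case (1 l)
      then show ?thesis
        using S.straighten_WH[of k "Suc l"] W_pos G single by simp
    next
      case (2 l)
      then show ?thesis
        using F.straighten_VW[of k l] W_pos G seq pair by simp
    qed
  next
    case (G_tilde k)
    with inverted consider l where "y = G_plain l" | l where "y = W_neg l" | l where "y = W_pos l"
      by (cases y) auto
    then show ?thesis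
    proof cases
      case (1 l)
      then show ?thesis
        using F.straighten_HG[of "Suc k" "Suc l"] G_tilde G seq pair by simp
    next
      case (2 l)
      then show ?thesis
        using F.straighten_HW[of "Suc k" l] G_tilde W single by simp
    next
      case (3 l)
      then show ?thesis
        using S.straighten_GW[of "Suc k" l] G_tilde V single by simp
    qed
  qed (use inverted in simp)
  then show ?thesis
    by (simp add: mon_Cons mon_Nil)
qed

text \<open>Induction on the word of types, ordered by length and then lexicographically. Rewriting
  an inverted pair either shortens the word or lowers the type at the first position of the
  pair.\<close>

lemma straighten_word:
  assumes N: "\<And>x y. x \<in> N \<Longrightarrow> y \<in> N \<Longrightarrow> x - y \<in> N" "\<And>c x. x \<in> N \<Longrightarrow> scalar c * x \<in> N" "alt_ideal q \<subseteq> N"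
    and sorted: "\<And>w. sorted (map gen_type w) \<Longrightarrow> mon w \<in> N"
  shows "mon w \<in> N"
proof (induction w rule: wf_induct[OF wf_inv_image[OF wf_lenlex[OF wf_less_than], of "map
    gen_type"]])
  case (1 w)
  then have IH: "mon w' \<in> N" if "(map gen_type w', map gen_type w) \<in> lenlex less_than" for w'
    using that by (simp add: inv_image_def)
  show ?case
  proof (cases "sorted (map gen_type w)")
    case False
    then obtain i where i: "Suc i < length w" "gen_type (w ! Suc i) < gen_type (w ! i)"
      by (auto simp: sorted_iff_nth_Suc not_le)
    define u v x y where defs: "u = take i w" "v = drop (Suc (Suc i)) w" "x = w ! i" "y = w ! Suc i"
    have w: "w = u @ [x, y] @ v"
      using i by (simp add: defs Cons_nth_drop_Suc id_take_nth_drop[symmetric])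
    \<comment> \<open>\<open>M\<close> turns the surroundings \<open>u\<close>, \<open>v\<close> of
      the pair into a condition on the pair alone. It contains the ideal because the ideal is
      two-sided.\<close>
    define M where "M = {f. mon u * f * mon v \<in> N}"
    have *: "mon u * (scalar c * f) * mon v = scalar c * (mon u * f * mon v)" for c f
      by (metis mult.assoc scalar_commute)
    have "mon [x, y] \<in> M"
    proof (rule straighten_pair)
      show "mon z \<in> M" if "length z \<le> 1" for z
        unfolding M_def mem_Collect_eq mon_append[symmetric]
        by (rule IH) (use that in \<open>simp add: w lenlex_conv\<close>)
      show "mon [x', y'] \<in> M" if "gen_type x' < gen_type x" for x' y'
        unfolding M_def mem_Collect_eq mon_append[symmetric]
        by (rule IH) (simp add: w lenlex_conv lex_append_leftI that)
      show "gen_type y < gen_type x"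
        using i by (simp add: defs)
      show "f - g \<in> M" if "f \<in> M" "g \<in> M" for f g
        using N(1)[of "mon u * f * mon v" "mon u * g * mon v"] that
        by (simp add: M_def left_diff_distrib right_diff_distrib)
      show "scalar c * f \<in> M" if "f \<in> M" for c f
        using N(2)[of "mon u * f * mon v" c] that unfolding M_def mem_Collect_eq * .
      show "alt_ideal q \<subseteq> M"
        using N(3) relation_ideal_left relation_ideal_right unfolding M_def by blast
    qed
    then show ?thesis
      by (simp only: M_def w mon_append mult.assoc mem_Collect_eq)
  qed (rule sorted)
qed

end

section \<open>Words that are nondecreasing for a compatible linear order\<close>

locale alternating_order =
  fixes r :: "alt_gen rel"
  assumes linear: "linear_order r"
    and G_W: "(G_plain i, W_neg j) \<in> r"
    and W_V: "(W_neg j, W_pos k) \<in> r"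
    and V_H: "(W_pos k, G_tilde l) \<in> r"
begin

definition words :: "alt_gen list set"
  where "words = nondecreasing_words UNIV r"

lemma r_trans: "(x, y) \<in> r \<Longrightarrow> (y, z) \<in> r \<Longrightarrow> (x, z) \<in> r"
  using linear by (auto simp: linear_order_on_def partial_order_on_def preorder_on_def dest: transD)

lemma r_refl: "(x, x) \<in> r"
  using linear by (auto simp: linear_order_on_def partial_order_on_def preorder_on_def refl_on_def)

lemma r_antisym: "(x, y) \<in> r \<Longrightarrow> (y, x) \<in> r \<Longrightarrow> x = y"
  using linear by (auto simp: linear_order_on_def partial_order_on_def dest: antisymD)

lemma r_total: "(x, y) \<in> r \<or> (y, x) \<in> r"
  using linear r_refl[of x] by (cases "x = y") (auto simp: linear_order_on_def total_on_def)

text \<open>Only neighbouring families are compared in the assumptions; transitivity supplies the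
  other comparisons.\<close>

lemma type_less: "gen_type x < gen_type y \<Longrightarrow> (x, y) \<in> r"
  by (cases x; cases y) (auto intro: G_W W_V V_H r_trans[OF G_W W_V] r_trans[OF W_V V_H]
      r_trans[OF G_W r_trans[OF W_V V_H]])

lemma words_Cons: "x # w \<in> words \<longleftrightarrow> (\<forall>y\<in>set w. (x, y) \<in> r) \<and> w \<in> words"
  by (auto simp: words_def nondecreasing_words_def)

text \<open>The first letter is the least one of the word, hence determined by the multiset. This
  links the words to \<open>independence\<close>, which distinguishes them by their
  multisets.\<close>

lemma words_unique: "v \<in> words \<Longrightarrow> w \<in> words \<Longrightarrow> mset v = mset w \<Longrightarrow> v = w"
proof (induction v arbitrary: w)
  case (Cons x v)
  then obtain y w' where w: "w = y # w'"
    by (cases w) auto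
  have "set (x # v) = set (y # w')"
    using Cons.prems(3) unfolding w by (rule mset_eq_setD)
  then have "y \<in> set (x # v)" "x \<in> set (y # w')"
    by auto
  then have "(x, y) \<in> r" "(y, x) \<in> r"
    using Cons.prems(1,2) r_refl by (auto simp: w words_Cons)
  then have "x = y"
    by (rule r_antisym)
  with Cons w show ?case
    by (simp add: words_Cons)
qed simp

context
  fixes q :: "'k::field"
  assumes q: "q \<noteq> 0" "q ^ 2 \<noteq> 1"
begin

text \<open>An insertion step of sorting: \<open>x\<close> passes only letters of its own type,
  since letters of larger type already come after it, and these exchanges are harmless modulo the
  ideal.\<close>

lemma insert_word:
  assumes "w \<in> words" "\<forall>y\<in>set w. gen_type x \<le> gen_type y"
  shows "\<exists>w'\<in>words. mset w' = add_mset x (mset w) \<and>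
    mon (x # w) - mon w' \<in> alt_ideal q"
  using assms
proof (induction w)
  case Nil
  then show ?case
    by (intro bexI[of _ "[x]"]) (simp_all add: relation_ideal_zero words_Cons)
next
  case (Cons y w)
  show ?case
  proof (cases "(x, y) \<in> r")
    case True
    with Cons.prems have "x # y # w \<in> words"
      using r_trans by (auto simp: words_Cons)
    then show ?thesis
      by (intro bexI[of _ "x # y # w"]) (simp_all add: relation_ideal_zero)
  next
    case False
    then have "(y, x) \<in> r" "\<not> gen_type x < gen_type y"
      using r_total type_less by blast+
    with Cons.prems have gen_type: "gen_type x = gen_type y"
      by auto
    obtain w' where w': "w' \<in> words" "mset w' = add_mset x (mset w)"
      "mon (x # w) - mon w' \<in> alt_ideal q"
      using Cons by (auto simp: words_Cons)
    have "y # w' \<in> words"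
      using Cons.prems(1) w' \<open>(y, x) \<in> r\<close> by (auto simp: words_Cons set_mset_mset[symmetric] simp
          del: set_mset_mset)
    moreover have eq: "mon (x # y # w) - mon (y # w') =
        (mon [x, y] - mon [y, x]) * mon w + gen y * (mon (x # w) - mon w')"
      by (simp add: mon_Cons mon_Nil algebra_simps)
    have "mon (x # y # w) - mon (y # w') \<in> alt_ideal q"
      unfolding eq
      by (intro relation_ideal_add relation_ideal_left relation_ideal_right
          same_type_commute[OF q gen_type] w'(3))
    ultimately show ?thesis
      using w'(2) by (intro bexI[of _ "y # w'"]) auto
  qed
qed

lemma sort_word:
  "sorted (map gen_type w) \<Longrightarrow> \<exists>w'\<in>words. mset w' = mset w \<and>
    mon w - mon w' \<in> alt_ideal q"
proof (induction w)
  case Nil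
  then show ?case
    by (intro bexI[of _ "[]"]) (simp_all add: relation_ideal_zero words_def nondecreasing_words_def)
next
  case (Cons x w)
  then obtain w' where w': "w' \<in> words" "mset w' = mset w"
      "mon w - mon w' \<in> alt_ideal q"
    by auto
  then have "set w' = set w"
    by (metis set_mset_mset)
  with Cons.prems insert_word[OF w'(1), of x]
  obtain w'' where w'': "w'' \<in> words" "mset w'' = add_mset x (mset w')"
      "mon (x # w') - mon w'' \<in> alt_ideal q"
    by auto
  have eq: "mon (x # w) - mon w'' = gen x * (mon w - mon w') + (mon (x # w') - mon w'')"
    by (simp add: mon_Cons algebra_simps)
  have "mon (x # w) - mon w'' \<in> alt_ideal q"
    unfolding eq by (intro relation_ideal_add relation_ideal_left w'(3) w''(3))
  with w' w'' show ?case
    by (intro bexI[of _ w'']) auto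
qed

text \<open>There are two stages: \<open>straighten_word\<close> reduces to words sorted by type,
  and \<open>sort_word\<close> arranges the letters of each type according to
  \<open>r\<close>.\<close>

theorem spanning:
  assumes N: "\<And>x y. x \<in> N \<Longrightarrow> y \<in> N \<Longrightarrow> x - y \<in> N" "\<And>c x. x \<in> N \<Longrightarrow> scalar c * x \<in> N"
      "alt_ideal q \<subseteq> N"
    and words: "\<And>w. w \<in> words \<Longrightarrow> mon w \<in> N"
  shows "x \<in> N"
proof -
  have minus: "- y \<in> N" if "y \<in> N" for y
    using N(1)[OF N(1)[OF that that] that] by simp
  have add: "y + z \<in> N" if "y \<in> N" "z \<in> N" for y z
    using N(1)[OF that(1) minus[OF that(2)]] by simp
  have "mon w \<in> N" if "sorted (map gen_type w)" for w
    using sort_word[OF that] words add N(3) by (metis diff_add_cancel subsetD)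
  then have "mon w \<in> N" for w
    using straighten_word[OF q N] by blast
  then show ?thesis
    by (induction x rule: free_algebra_induct) (auto intro: N(2) add)
qed

end
end

section \<open>Linear independence\<close>

definition word_value :: "('g \<Rightarrow> 'b::monoid_mult) \<Rightarrow> 'g free_monoid \<Rightarrow> 'b"
  where "word_value im w = (case w of Word xs \<Rightarrow> prod_list (map im xs))"

text \<open>The homomorphism from the free algebra to the operators that extends
  \<open>im\<close>.\<close>

definition evaluate :: "('g \<Rightarrow> ('i, 'k) lin_op) \<Rightarrow> ('g, 'k::field) free_algebra \<Rightarrow> ('i, 'k) lin_op"
  where "evaluate im f = (\<Sum>w\<in>Poly_Mapping.keys f. scalar_op (Poly_Mapping.lookup f w) * word_value
      im w)"

lemma evaluate_superset:
  assumes "finite A" "Poly_Mapping.keys f \<subseteq> A"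
  shows "evaluate im f = (\<Sum>w\<in>A. scalar_op (Poly_Mapping.lookup f w) * word_value im w)"
  unfolding evaluate_def using assms
  by (intro sum.mono_neutral_left) (auto simp: in_keys_iff scalar_op_simps)

lemma evaluate_add: "evaluate im (f + g) = evaluate im f + evaluate im g"
proof -
  let ?A = "Poly_Mapping.keys f \<union> Poly_Mapping.keys g"
  have "Poly_Mapping.keys (f + g) \<subseteq> ?A"
    by (rule Poly_Mapping.keys_add)
  then show ?thesis
    by (simp add: evaluate_superset[of ?A] lookup_add scalar_op_simps distrib_right sum.distrib)
qed

lemma evaluate_mon: "evaluate im (scalar c * mon w) = scalar_op c * prod_list (map im w)"
proof -
  have "evaluate im (Poly_Mapping.single (Word w) c) = scalar_op c * prod_list (map im w)"
    by (simp add: evaluate_superset[of "{Word w}"] word_value_def)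
  then show ?thesis
    by (simp add: single_mon)
qed

lemma evaluate_mult: "evaluate im (f * g) = evaluate im f * evaluate im g"
proof (induction f rule: free_algebra_induct)
  case (mon c v)
  show ?case
  proof (induction g rule: free_algebra_induct)
    case (mon d w)
    have "scalar c * mon v * (scalar d * mon w) = scalar c * (mon v * scalar d) * mon w"
      by (simp only: mult.assoc)
    also have "\<dots> = scalar (c * d) * mon (v @ w)"
      unfolding scalar_commute[of "mon v"] by (simp only: mon_append scalar_simps(2) mult.assoc)
    finally have *: "scalar c * mon v * (scalar d * mon w) = scalar (c * d) * mon (v @ w)" .
    have "scalar_op c * prod_list (map im v) * (scalar_op d * prod_list (map im w))
        = scalar_op c * (prod_list (map im v) * scalar_op d) * prod_list (map im w)"
      by (simp only: mult.assoc)
    also have "\<dots> = scalar_op (c * d) * prod_list (map im (v @ w))"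
      unfolding scalar_op_central[of "prod_list (map im v)"]
      by (simp only: map_append prod_list.append scalar_op_simps(5) mult.assoc)
    finally show ?case
      unfolding * evaluate_mon by simp
  qed (simp add: distrib_left evaluate_add)
qed (simp add: distrib_right evaluate_add)

lemma evaluate_scalar: "evaluate im (scalar c) = scalar_op c"
  using evaluate_mon[of im c "[]"] by (simp add: mon_Nil)

lemma evaluate_gen: "evaluate im (gen g) = im g"
  using evaluate_mon[of im 1 "[g]"] by (simp add: mon_single scalar_simps scalar_op_simps)

lemma evaluate_zero: "evaluate im 0 = 0"
  by (simp add: evaluate_def)

lemma evaluate_diff: "evaluate im (f - g) = evaluate im f - evaluate im g"
  using evaluate_add[of im "f - g" g] by simp

lemma evaluate_sum: "evaluate im (sum f A) = (\<Sum>x\<in>A. evaluate im (f x))"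
  by (induction A rule: infinite_finite_induct) (simp_all add: evaluate_zero evaluate_add)

lemmas evaluate_simps = evaluate_add evaluate_mult evaluate_scalar evaluate_gen evaluate_zero
  evaluate_diff

section \<open>Recovering the letters of a word from its leading exponent\<close>

primrec exponent :: "alt_gen \<Rightarrow> coord multiset" where
  "exponent (W_neg k) = exp_W k"
| "exponent (W_pos k) = exp_V k"
| "exponent (G_plain k) = exp_G (Suc k)"
| "exponent (G_tilde k) = exp_H (Suc k)"

text \<open>A left inverse of the exponent map.\<close>

primrec letter_count :: "coord multiset \<Rightarrow> alt_gen \<Rightarrow> int" where
  "letter_count M (W_neg k) = int (count M (XB k)) - int (count M (XS k)) - int (count M (XT k))"
| "letter_count M (W_pos k) = int (count M (XC k))"
| "letter_count M (G_plain k) = int (count M (XS k)) - int (count M (XB (Suc k)))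
    + int (count M (XT (Suc k)))"
| "letter_count M (G_tilde k) = int (count M (XT k)) - int (count M (XT (Suc k)))
    - int (count M (XC (Suc k)))"

lemma count_exp:
  "count (exp_G k) (XS i) = (if i < k then 1 else 0)" "count (exp_G k) (XB i) = (if i < k then 1
      else 0)"
  "count (exp_G k) (XT i) = 0" "count (exp_G k) (XC i) = 0"
  "count (exp_H k) (XT i) = (if i < k then 1 else 0)" "count (exp_H k) (XB i) = (if i < k then 1
      else 0)"
  "count (exp_H k) (XS i) = 0" "count (exp_H k) (XC i) = 0"
  by (induction k) auto

text \<open>\<open>exp_G k\<close> and \<open>exp_H k\<close> involve exactly the sites below
  \<open>k\<close>, so differences of counts at neighbouring sites detect \<open>k\<close>; the
  remaining terms cancel the contributions of the other families.\<close>

lemma letter_count_exponent: "letter_count (exponent g) h = (if g = h then 1 else 0)"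
  by (cases g; cases h) (auto simp: exp_W_def exp_V_def count_exp simp del: exp_G.simps exp_H.simps)

lemma letter_count_empty: "letter_count {#} h = 0"
  by (cases h) auto

lemma letter_count_add: "letter_count (M + N) h = letter_count M h + letter_count N h"
  by (cases h) auto

definition word_exponent :: "alt_gen list \<Rightarrow> coord multiset"
  where "word_exponent w = (\<Sum>g\<leftarrow>w. exponent g)"

lemma letter_count_word: "letter_count (word_exponent w) h = int (count (mset w) h)"
  by (induction w) (simp_all add: word_exponent_def letter_count_empty letter_count_add
      letter_count_exponent)

lemma word_exponent_eqD: "word_exponent v = word_exponent w \<Longrightarrow> mset v = mset w"
  by (rule multiset_eqI) (metis letter_count_word of_nat_eq_iff)

text \<open>Among the indices with nonzero coefficient, take one whose top has maximal weight. No
  other vector with nonzero coefficient involves this monomial, as its own top would have to be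
  heavier.\<close>

lemma unique_top_independent:
  assumes "finite A" "inj_on e A" "\<And>w. w \<in> A \<Longrightarrow> unique_top (v w) (e w)"
    and sum: "\<And>M. (\<Sum>w\<in>A. c w * v w M) = (0::'k::field)" and w: "w \<in> A"
  shows "c w = 0"
proof (rule ccontr)
  let ?B = "{w \<in> A. c w \<noteq> 0}"
  assume "c w \<noteq> 0"
  with w have B: "finite ?B" "?B \<noteq> {}"
    using assms(1) by auto
  define m where "m = Max ((\<lambda>w. weight (e w)) ` ?B)"
  have "m \<in> (\<lambda>w. weight (e w)) ` ?B"
    unfolding m_def using B by (intro Max_in) auto
  then obtain x where x: "x \<in> A" "c x \<noteq> 0" "weight (e x) = m"
    by auto
  have le: "weight (e y) \<le> m" if "y \<in> ?B" for y
    unfolding m_def using B that by (intro Max_ge) auto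
  have "c y * v y (e x) = 0" if y: "y \<in> A - {x}" for y
  proof (rule ccontr)
    assume "c y * v y (e x) \<noteq> 0"
    then have "y \<in> ?B" "v y (e x) \<noteq> 0"
      using y by auto
    moreover have "e x \<noteq> e y"
      using y x(1) assms(2) by (auto dest: inj_onD)
    ultimately have "weight (e x) < weight (e y)"
      using assms(3)[of y] y by (auto simp: unique_top_def)
    with le[OF \<open>y \<in> ?B\<close>] x(3) show False
      by simp
  qed
  then have "(\<Sum>w\<in>A. c w * v w (e x)) = c x * v x (e x)"
    using assms(1) x(1) by (simp add: sum.remove[of A x] sum.neutral)
  with sum[of "e x"] assms(3)[OF x(1)] x(2) show False
    by (simp add: unique_top_def)
qed

primrec index :: "alt_gen \<Rightarrow> nat" where
  "index (W_neg k) = k" | "index (W_pos k) = k" | "index (G_plain k) = k" | "index (G_tilde k) = k"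

context
  fixes q :: "'k::field"
  assumes q: "q \<noteq> 0" "q ^ 2 \<noteq> 1"
begin

text \<open>This is \<open>model\<close> for \<open>r = q ^ 2\<close>, turned into a map that kills
  the ideal. As \<open>G_plain k\<close> goes to \<open>G (Suc k)\<close>, \<open>n\<close> factors
  control all four families for indices below \<open>n\<close>.\<close>

lemma evaluation:
  obtains im :: "alt_gen \<Rightarrow> (coord multiset, 'k) lin_op"
  where "\<And>x. x \<in> alt_ideal q \<Longrightarrow> evaluate im x = 0"
    and "\<And>g. index g < n \<Longrightarrow> lead (im g) (exponent g)"
proof -
  have q2: "q ^ 2 \<noteq> 0"
    using q by simp
  obtain W V G H :: "nat \<Rightarrow> (coord multiset, 'k) lin_op"
    where alt: "alternating {0} (scalar_op (inverse (q ^ 2))) (scalar_op (q ^ 2))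
        (scalar_op (inverse (1 - inverse (q ^ 2)))) W V G H"
    and leads: "leads n W exp_W" "leads n V exp_V" "leads (Suc n) G exp_G" "leads (Suc n) H exp_H"
    by (rule model[OF q2 q(2)])
  interpret alternating "{0}" "scalar_op (inverse (q ^ 2))" "scalar_op (q ^ 2)"
      "scalar_op (inverse (1 - inverse (q ^ 2)))" W V G H
    by (rule alt)
  define im where "im g = (case g of W_neg k \<Rightarrow> W k | W_pos k \<Rightarrow> V k | G_plain k \<Rightarrow> G (Suc k)
    | G_tilde k \<Rightarrow> H (Suc k))" for g
  have [simp]: "im (W_neg k) = W k" "im (W_pos k) = V k" "im (G_plain k) = G (Suc k)"
      "im (G_tilde k) = H (Suc k)" for k
    by (simp_all add: im_def)
  have com: "evaluate im (comm x y) = bracket (evaluate im x) (evaluate im y)" for x y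
    by (simp add: comm_def bracket_def evaluate_simps)
  have qcom: "evaluate im (qcomm q x y) = scalar_op q * qbracket (scalar_op (inverse (q ^ 2)))
      (evaluate im x) (evaluate im y)"
    for x y
  proof -
    have "scalar_op q * (scalar_op (inverse (q ^ 2)) * z) = scalar_op (inverse q) * z" for z ::
        "(coord multiset, 'k) lin_op"
      using q by (simp add: mult.assoc[symmetric] scalar_op_simps(5)[symmetric] power2_eq_square)
    then show ?thesis
      by (simp add: qcomm_def qbracket_def evaluate_simps right_diff_distrib mult.assoc)
  qed
  have scale: "scalar_op q * ((1 - scalar_op (inverse (q ^ 2))) * z) = scalar_op (q - inverse q) *
      z"
    for z :: "(coord multiset, 'k) lin_op"
  proof -
    have *: "q * (1 - inverse (q ^ 2)) = q - inverse q"
      using q by (simp add: right_diff_distrib power2_eq_square)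
    show ?thesis
      unfolding *[symmetric] by (simp only: scalar_op_simps mult.assoc)
  qed
  have rel: "evaluate im (x - y) = 0" if "(x, y) \<in> alt_relations q" for x y
    using that
  proof cases
    case (1 k) then show ?thesis
      using WV_0[of k] by (simp add: evaluate_simps com scalar_op_simps(2,4) power_inverse)
  next
    case (2 k)
    have "bracket (W k) (V 0) = (1 - scalar_op (inverse (q ^ 2))) * (H (Suc k) - G (Suc k))"
      using VW_0[of k] by (simp add: bracket_def algebra_simps)
    with 2 show ?thesis
      by (simp add: evaluate_simps com scalar_op_simps(2,4) power_inverse)
  next
    case (3 k) then show ?thesis
      using WG_0[of "Suc k"] scale[of "W (Suc k)"] by (simp add: evaluate_simps qcom)
  next
    case (4 k) then show ?thesis
      using HW_0[of "Suc k"] scale[of "W (Suc k)"] by (simp add: evaluate_simps qcom)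
  next
    case (5 k) then show ?thesis
      using GV_0[of "Suc k"] scale[of "V (Suc k)"] by (simp add: evaluate_simps qcom)
  next
    case (6 k) then show ?thesis
      using VH_0[of "Suc k"] scale[of "V (Suc k)"] by (simp add: evaluate_simps qcom)
  next
    case (7 k l) then show ?thesis
      using WW[of k l] by (simp add: evaluate_simps com)
  next
    case (8 k l) then show ?thesis
      using VV[of k l] by (simp add: evaluate_simps com)
  next
    case (9 k l) then show ?thesis
      using WV[of k l] by (simp add: evaluate_simps com bracket_def)
  next
    case (10 k l) then show ?thesis
      using WG[of k l] by (simp add: evaluate_simps com bracket_def)
  next
    case (11 k l) then show ?thesis
      using WH[of k l] by (simp add: evaluate_simps com bracket_def)
  next
    case (12 k l) then show ?thesis
      using VG[of k l] by (simp add: evaluate_simps com bracket_def)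
  next
    case (13 k l) then show ?thesis
      using VH[of k l] by (simp add: evaluate_simps com bracket_def)
  next
    case (14 k l) then show ?thesis
      using GG[of "Suc k" "Suc l"] by (simp add: evaluate_simps com)
  next
    case (15 k l) then show ?thesis
      using HH[of "Suc k" "Suc l"] by (simp add: evaluate_simps com)
  next
    case (16 k l) then show ?thesis
      using HG[of "Suc k" "Suc l"] by (simp add: evaluate_simps com bracket_def)
  qed
  show thesis
  proof (rule that)
    show "evaluate im x = 0" if "x \<in> alt_ideal q" for x
      by (rule relation_ideal_minimal[OF evaluate_add evaluate_mult rel that])
    show "lead (im g) (exponent g)" if "index g < n" for g
      using leads that unfolding leads_def by (cases g) (simp_all del: exp_G.simps exp_H.simps)
  qed
qed

theorem independence:
  assumes A: "finite A" "inj_on mset A"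
    and sum: "(\<Sum>w\<in>A. scalar (c w) * mon w) \<in> alt_ideal q"
    and w: "w \<in> A"
  shows "c w = 0"
proof -
  \<comment> \<open>Enough factors for all letters that occur; \<open>insert 0\<close> covers the
    case that there are none.\<close>
  define n where "n = Suc (Max (insert 0 (index ` \<Union> (set ` A))))"
  have n: "index g < n" if "v \<in> A" "g \<in> set v" for v g
    unfolding n_def less_Suc_eq_le using A(1) that by (intro Max_ge) auto
  obtain im :: "alt_gen \<Rightarrow> (coord multiset, 'k) lin_op"
    where zero: "\<And>x. x \<in> alt_ideal q \<Longrightarrow> evaluate im x = 0"
    and lead_gen: "\<And>g. index g < n \<Longrightarrow> lead (im g) (exponent g)"
    using evaluation[of n] by blast
  have lead: "lead (prod_list (map im v)) (word_exponent v)" if "\<And>g. g \<in> set v \<Longrightarrow> index g < n" for v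
    using that by (induction v) (auto simp: word_exponent_def lead_one lead_mult lead_gen)
  \<comment> \<open>The vector of the monomial 1, on which a product of operators exhibits its
    leading exponent as the top.\<close>
  define vac :: "coord multiset \<Rightarrow> 'k" where "vac M = (if M = {#} then 1 else 0)" for M
  have vac: "unique_top vac {#}"
    by (simp add: unique_top_def vac_def)
  have tops: "unique_top (app (prod_list (map im v)) vac) (word_exponent v)" if "v \<in> A" for v
  proof -
    have "lead (prod_list (map im v)) (word_exponent v)"
      using n[OF that] by (rule lead)
    then have "unique_top (app (prod_list (map im v)) vac) (word_exponent v + {#})"
      using vac unfolding lead_def by blast
    then show ?thesis
      by simp
  qed
  have inj: "inj_on word_exponent A"
    using A(2) by (auto simp: inj_on_def dest: word_exponent_eqD)
  have combination: "(\<Sum>w\<in>A. c w * app (prod_list (map im w)) vac M) = 0" for M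
  proof -
    have "app (sum f B) v M = (\<Sum>w\<in>B. app (f w) v M)" if "finite B"
      for f :: "alt_gen list \<Rightarrow> (coord multiset, 'k) lin_op" and B v
      using that by (induction B) (simp_all add: app_simps)
    note app_sum = this[OF A(1)]
    have "(\<Sum>w\<in>A. c w * app (prod_list (map im w)) vac M)
        = app (evaluate im (\<Sum>w\<in>A. scalar (c w) * mon w)) vac M"
      by (simp add: evaluate_sum evaluate_mon app_sum times_lin_op.rep_eq scalar_op.rep_eq)
    then show ?thesis
      unfolding zero[OF sum] by (simp add: zero_lin_op.rep_eq)
  qed
  show ?thesis
    by (rule unique_top_independent[OF A(1) inj tops combination w])
qed

end

section \<open>The basis\<close>

lemma scalar_uminus: "scalar (- a) = - scalar a"
  by (simp add: scalar_def single_uminus)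

lemma list_prod_coset:
  "list_prod (presented_algebra E) (map (\<lambda>g. coset E (gen g)) w) = coset E (mon w)"
  by (induction w) (simp_all add: list_prod_def presented_algebra_simps mon_Nil mon_Cons)

lemma finsum_coset:
  "finite A \<Longrightarrow> (\<Oplus>\<^bsub>presented_algebra E\<^esub>v\<in>A. coset E (f v)) = coset E (\<Sum>v\<in>A. f v)"
proof (induction A rule: finite_induct)
  interpret assoc_algebra class_ring "presented_algebra E"
    by (rule assoc_algebra_presented_algebra)
  case empty
  show ?case
    by (simp add: presented_algebra_simps)
next
  interpret assoc_algebra class_ring "presented_algebra E"
    by (rule assoc_algebra_presented_algebra)
  case (insert v A)
  then show ?case
    by (simp add: finsum_insert Pi_def presented_algebra_simps)
qed

context alternating_order
begin

context
  fixes q :: "'k::field"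
  assumes q: "q \<noteq> 0" "q ^ 2 \<noteq> 1"
begin

abbreviation "word_coset w \<equiv> coset (alt_relations q) (mon w)"

lemma inj_on_mset_words: "inj_on mset words"
  by (rule inj_onI) (rule words_unique)

lemma inj_on_word_coset: "inj_on word_coset words"
proof (rule inj_onI, rule ccontr)
  fix v w assume vw: "v \<in> words" "w \<in> words" "word_coset v = word_coset w" "v \<noteq> w"
  \<comment> \<open>Equal cosets of different words would be a linear relation with coefficients 1
    and -1.\<close>
  let ?c = "\<lambda>x. if x = v then 1 else - 1 :: 'k"
  have "(\<Sum>x\<in>{v, w}. scalar (?c x) * mon x) = mon v - mon w"
    using vw(4) by (simp add: scalar_uminus scalar_simps(3))
  then have "(\<Sum>x\<in>{v, w}. scalar (?c x) * mon x) \<in> alt_ideal q"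
    using vw(3) by (simp add: coset_eq_iff)
  moreover have "inj_on mset {v, w}"
    using vw by (intro inj_on_subset[OF inj_on_mset_words]) simp
  ultimately have "?c v = 0"
    by (intro independence[OF q]) auto
  then show False
    by simp
qed

lemma inj_alt_elem: "inj (alt_elem q)"
proof (rule injI)
  fix g h assume "alt_elem q g = alt_elem q h"
  then have "word_coset [g] = word_coset [h]"
    by (simp add: alt_elem_def mon_single)
  moreover have "[x] \<in> words" for x
    by (simp add: words_def nondecreasing_words_def)
  ultimately show "g = h"
    using inj_on_word_coset by (auto dest: inj_onD)
qed

lemma list_prod_alt: "list_prod (alt_algebra q) (map (alt_elem q) w) = word_coset w"
  unfolding alt_algebra_def alt_elem_def[abs_def] by (rule list_prod_coset)

lemma alt_elem_order:
  "(alt_elem q x, alt_elem q y) \<in> map_prod (alt_elem q) (alt_elem q) ` r \<longleftrightarrow> (x, y) \<in> r"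
  using inj_alt_elem by (auto simp: inj_eq)

lemma nondecreasing_words_alt:
  "nondecreasing_words (range (alt_elem q)) (map_prod (alt_elem q) (alt_elem q) ` r)
    = map (alt_elem q) ` words"
proof
  show "nondecreasing_words (range (alt_elem q)) (map_prod (alt_elem q) (alt_elem q) ` r)
      \<subseteq> map (alt_elem q) ` words"
  proof
    fix xs assume
      xs: "xs \<in> nondecreasing_words (range (alt_elem q)) (map_prod (alt_elem q) (alt_elem q) ` r)"
    then have "xs \<in> lists (range (alt_elem q))"
      by (auto simp: nondecreasing_words_def)
    then obtain w where "xs = map (alt_elem q) w"
      unfolding lists_image by auto
    with xs show "xs \<in> map (alt_elem q) ` words"
      by (auto simp: nondecreasing_words_def words_def sorted_wrt_map alt_elem_order)
  qed
qed (auto simp: nondecreasing_words_def words_def sorted_wrt_map alt_elem_order)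

lemma products: "list_prod (alt_algebra q) ` map (alt_elem q) ` words = word_coset ` words"
  by (simp add: image_image list_prod_alt)

lemma linear_order_alt:
  "linear_order_on (range (alt_elem q)) (map_prod (alt_elem q) (alt_elem q) ` r)"
  unfolding linear_order_on_def partial_order_on_def preorder_on_def
proof (intro conjI)
  let ?r = "map_prod (alt_elem q) (alt_elem q) ` r"
  note inj = inj_eq[OF inj_alt_elem]
  show "?r \<subseteq> range (alt_elem q) \<times> range (alt_elem q)"
    by auto
  show "refl_on (range (alt_elem q)) ?r"
    using r_refl by (force simp: refl_on_def)
  show "trans ?r"
    by (rule transI) (auto simp: inj alt_elem_order intro: r_trans)
  show "antisym ?r"
    by (rule antisymI) (auto simp: inj dest: r_antisym)
  show "total_on (range (alt_elem q)) ?r"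
    using r_total by (force simp: total_on_def)
qed

theorem PBW:
  "assoc_algebra.PBW_basis class_ring (alt_algebra q)
    (range (alt_elem q)) (map_prod (alt_elem q) (alt_elem q) ` r)"
proof -
  let ?S = "word_coset ` words"
  interpret assoc_algebra class_ring "alt_algebra q"
    by (rule assoc_algebra_alt_algebra)
  have carrier: "carrier (alt_algebra q) = range (coset (alt_relations q))"
    by (simp add: alt_algebra_def presented_algebra_simps)
  then have S: "?S \<subseteq> carrier (alt_algebra q)"
    by auto
  have zero: "\<zero>\<^bsub>alt_algebra q\<^esub> = coset (alt_relations q) 0"
    by (simp add: alt_algebra_def presented_algebra_simps)
  have "lin_indpt ?S"
  proof
    assume "lin_dep ?S"
    then obtain B a v where B: "finite B" "B \<subseteq> ?S" "lincomb a B = \<zero>\<^bsub>alt_algebra q\<^esub>" "v \<in> B" "a v \<noteq>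
        0"
      unfolding lin_dep_def by auto
    \<comment> \<open>The dependence is pulled back to words: its coefficients belong to cosets, and
      injectivity on \<open>V\<close> allows reindexing the sum by words.\<close>
    then obtain V where V: "V \<subseteq> words" "finite V" "B = word_coset ` V"
      by (metis finite_subset_image)
    have inj: "inj_on word_coset V"
      using inj_on_word_coset V(1) by (rule inj_on_subset)
    have "lincomb a B = (\<Oplus>\<^bsub>alt_algebra q\<^esub>w\<in>V. a (word_coset w) \<odot>\<^bsub>alt_algebra q\<^esub> word_coset w)"
      unfolding lincomb_def V(3) using inj S V(1)
      by (intro finsum_reindex) (auto intro!: smult_closed)
    also have "\<dots> = coset (alt_relations q) (\<Sum>w\<in>V. scalar (a (word_coset w)) * mon w)"
      unfolding alt_algebra_def presented_algebra_simps by (rule finsum_coset) (rule V)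
    finally have "coset (alt_relations q) (\<Sum>w\<in>V. scalar (a (word_coset w)) * mon w)
        = coset (alt_relations q) 0"
      unfolding B(3) zero by (rule sym)
    then have sum: "(\<Sum>w\<in>V. scalar (a (word_coset w)) * mon w) \<in> alt_ideal q"
      unfolding coset_eq_iff by simp
    obtain w where w: "w \<in> V" "v = word_coset w"
      using B(4) V(3) by auto
    have "a (word_coset w) = 0"
      using inj_on_subset[OF inj_on_mset_words V(1)] by (rule independence[OF q V(2) _ sum w(1)])
    with B(5) w(2) show False
      by simp
  qed
  moreover have "span ?S = carrier (alt_algebra q)"
  proof
    show "span ?S \<subseteq> carrier (alt_algebra q)"
      using span_is_subset2[OF S] .
    interpret S: submodule class_ring "span ?S" "alt_algebra q"
      by (rule span_is_submodule[OF S])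
    \<comment> \<open>The preimage of the span in the free algebra, to which \<open>spanning\<close>
      applies.\<close>
    define N where "N = {f. coset (alt_relations q) f \<in> span ?S}"
    have scale: "scalar c * f \<in> N" if "f \<in> N" for c f
      using that S.smult_closed[of c "coset (alt_relations q) f"]
      by (simp add: N_def alt_algebra_def presented_algebra_simps)
    have add: "f + g \<in> N" if "f \<in> N" "g \<in> N" for f g
      using that S.m_closed[of "coset (alt_relations q) f" "coset (alt_relations q) g"]
      by (simp add: N_def alt_algebra_def presented_algebra_simps)
    have "f \<in> N" for f
    proof (rule spanning[OF q])
      show "f - g \<in> N" if "f \<in> N" "g \<in> N" for f g
        using add[OF that(1) scale[OF that(2), of "- 1"]]
        by (simp add: scalar_uminus scalar_simps(3))
      show "alt_ideal q \<subseteq> N"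
      proof
        fix f assume "f \<in> alt_ideal q"
        then have "coset (alt_relations q) f = \<zero>\<^bsub>alt_algebra q\<^esub>"
          by (simp add: zero coset_eq_iff)
        then show "f \<in> N"
          using S.zero_closed by (simp add: N_def)
      qed
      show "mon w \<in> N" if "w \<in> words" for w
        using in_own_span[OF S] that by (auto simp: N_def)
    qed (rule scale)
    then show "carrier (alt_algebra q) \<subseteq> span ?S"
      unfolding carrier N_def by auto
  qed
  moreover have "range (alt_elem q) \<subseteq> carrier (alt_algebra q)"
    by (auto simp: carrier alt_elem_def)
  moreover have "inj_on (list_prod (alt_algebra q)) (map (alt_elem q) ` words)"
    using inj_on_word_coset by (auto simp: inj_on_def list_prod_alt)
  ultimately show ?thesis
    unfolding PBW_basis_def nondecreasing_words_alt products basis_def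
    using linear_order_alt S by (intro conjI)
qed

end
end

text \<open>The order is given on the letters and transported to the algebra. Injectivity of
  \<open>alt_elem q\<close> ensures that different letters stay different there.\<close>

theorem proposition8p5:
  fixes q :: "'k::field" and r :: "alt_gen rel"
  assumes "q \<noteq> 0"
    and "\<forall>n>0. q ^ n \<noteq> 1"
    and "linear_order r"
    and "\<forall>i j. (G_plain i, W_neg j) \<in> r"
    and "\<forall>j k. (W_neg j, W_pos k) \<in> r"
    and "\<forall>k l. (W_pos k, G_tilde l) \<in> r"
  shows "inj (alt_elem q) \<and>
    assoc_algebra.PBW_basis class_ring (alt_algebra q)
      (range (alt_elem q)) (map_prod (alt_elem q) (alt_elem q) ` r)"
proof -
  interpret alternating_order r
    by unfold_locales (use assms in auto)
  have "q ^ 2 \<noteq> 1"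
    using assms(2) by simp
  with assms(1) show ?thesis
    using inj_alt_elem PBW by blast
qed

end
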